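(* The following identities hold. (a) $$\sum_{n=1}^{\infty}\frac{H_n^{(2)}}{n}x^n = 2Li_3(1-x)-2\zeta(3)+Li_3(x)-\log(1-x)\left[Li_2(1-x)+\zeta(2)\right].$$ (b) $$\sum_{n=1}^{\infty}\frac{H_n^{(2)}}{n2^n}=\frac{5}{8}\zeta(3).$$ (c) $$\sum_{n=1}^{\infty}\frac{H_n^{(1)}}{n^s}x^n=\int_0^x\frac{Li_s(x)-Li_s(y)}{x-y}\,dy.$$ (d) $$\sum_{n=1}^{\infty}\frac{H_n^{(1)}}{n^3}=\frac12\zeta^2(2)=\frac{\pi^4}{72}=\frac54\zeta(4).$$ (e) $$\sum_{n=1}^{\infty}\frac{\left(H_n^{(1)}\right)^2}{n^2}=\frac{17}{360}\pi^4=\frac{17}{4}\zeta(4).$$ (f) $$\sum_{n=1}^{\infty}\frac{H_n^{(3)}}{n2^n}=\zeta(2)\log^2 2-\frac78\zeta(3)\log 2+Li_4(1/2)-\frac16\log^4 2.$$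
   Context: $H_n^{(r)}=\sum_{k=1}^n \frac{1}{k^r}$ denotes the generalized harmonic number; $\left(H_n^{(1)}\right)^2$ is the square of $H_n^{(1)}$. $\zeta$ is the Riemann zeta function, and $\zeta^2(2)=(\zeta(2))^2$. $Li_s(x)=\sum_{n=1}^\infty \frac{x^n}{n^s}$ is the polylogarithm. $\log$ is the natural logarithm, and $\log^k 2=(\log 2)^k$. The theorem is stated without specifying ranges for $x$ in (a) or for $x$ and $s$ in (c).
   Formalization: Printed (f) is false (left side > 0.64, right side ≈ 0.540); its right side is replaced by Li_4(1/2) + (7/8)ζ(3)log 2 − (1/4)ζ(2)log²2 + (1/24)log⁴2 − (5/16)ζ(4). In (a), x is complex with |x| ≤ 1, |1−x| ≤ 1, x ≠ 1; in (c), x and s range over where the left series converges. *)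

theory Defs
  imports "HOL-Complex_Analysis.Complex_Analysis"
begin

definition gen_harm :: "nat \<Rightarrow> nat \<Rightarrow> 'a :: real_normed_field" where
  "gen_harm r n = (\<Sum>k = 1..n. 1 / of_nat k ^ r)"

text \<open>
  The polylogarithm and the Riemann zeta function are given by their Dirichlet-type series, at the
  types \<^typ>\<open>real\<close> and \<^typ>\<open>complex\<close> alike; the summation index is shifted by one. There is no
  analytic continuation: the values are meaningful only where the series converge, i.e. for
  \<open>polylog s x\<close> if \<open>norm x < 1\<close>, or \<open>norm x = 1\<close> and \<open>Re s > 1\<close>, or
  \<open>norm x = 1\<close>, \<open>x \<noteq> 1\<close> and \<open>Re s > 0\<close>; and for \<open>zeta s\<close> if \<open>Re s > 1\<close>.
\<close>

definition polylog :: "'a \<Rightarrow> 'a \<Rightarrow> 'a :: {ln, real_normed_field}" where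
  "polylog s x = (\<Sum>n. x ^ Suc n / of_nat (Suc n) powr s)"

definition zeta :: "'a \<Rightarrow> 'a :: {ln, real_normed_field}" where
  "zeta s = (\<Sum>n. 1 / of_nat (Suc n) powr s)"

end

(*
  (a), (f): the generating function of the H_n^(r) / n has derivative Li_r(x) / (x (1 - x)), so both
  sides have the same derivative by the reflection formula Li_2(x) + Li_2(1-x) = zeta(2) - ln x ln(1-x);
  in (a) one moves along the segment from 0 to x, which stays inside the lens |z| < 1, |1 - z| < 1,
  and reaches the boundary by Abel's theorem.  (b) is (a) at 1/2, where Landen's identities give
  Li_2(1/2) and Li_3(1/2).

  (c): with the tails R_k = sum_{n > k} x^n / n^s, summation by parts turns the integrand along y = u x
  into sum_k R_k u^k, whose antiderivative at u = 1 is sum_k R_k / (k + 1) = sum_n H_n x^n / n^s.  The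
  boundary term H_N R_N vanishes in the limit by Abel's inequality as soon as this last series converges.

  (d), (e): the stuffle and shuffle relations for zeta(2)^2 and Euler's sum formula determine zeta(4),
  zeta(3,1) and zeta(2,2) as multiples of zeta(2)^2 = pi^4 / 36; the remaining quadratic sum is found by
  evaluating sum_n H_n / n * sum_k 1 / (k (n + k)) along antidiagonals.
*)
theory Submission
  imports Defs "HOL-Real_Asymp.Real_Asymp"
begin

subsection \<open>Harmonic sums and double zeta values\<close>

text \<open>Polylogarithms are bare series here, so (a) can only be posed where the series at
  \<open>x\<close> and at \<open>1 - x\<close> both converge: a lens. Its boundary contains the
  starting point 0, where \<open>ln\<close> is singular, and an arc of |x| = 1 on which the series
  in (a) converges only conditionally. In (c) the same happens for |x| = 1 and 0 < Re s \<le> 1.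
  Hence the use of Abel's inequality where an M-test would fail, and the separation of interior
  points (derivatives) from endpoints (continuity). In weight 4 no value of zeta(4) is presupposed:
  three linear relations give zeta(2)^2 = 5/2 zeta(4), and the Basel sum then yields zeta(4). The
  quadratic sum in (e) needs one further double series, in which the unknown reappears and cancels.
  The closed form proved for (f) is not the one in the English text; see the remark at the
  theorem.\<close>

lemma gen_harm_0 [simp]: "gen_harm r 0 = 0"
  by (simp add: gen_harm_def)

lemma gen_harm_Suc: "gen_harm r (Suc n) = gen_harm r n + 1 / of_nat (Suc n) ^ r"
  by (simp add: gen_harm_def)

lemma gen_harm_altdef: "gen_harm r n = (\<Sum>k<n. 1 / of_nat (Suc k) ^ r)"
  by (induction n) (simp_all add: gen_harm_Suc)

lemma gen_harm_nonneg: "gen_harm r n \<ge> (0 :: real)"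
  unfolding gen_harm_def by (intro sum_nonneg) auto

lemma gen_harm_1_eq_harm: "gen_harm (Suc 0) n = harm n"
  by (simp add: gen_harm_def harm_def divide_inverse)

text \<open>Tonelli's theorem for double series: by nonnegativity, convergent row sums with a
  convergent total already give absolute summability over all pairs, and the pairs may then be
  grouped by \<open>i + j = N\<close>.\<close>

lemma nonneg_rows_sums_diagonals:
  fixes f :: "nat \<Rightarrow> nat \<Rightarrow> real"
  assumes nonneg: "\<And>i j. f i j \<ge> 0"
    and rows: "\<And>i. f i sums g i" and total: "g sums S"
  shows "(\<lambda>N. \<Sum>i\<le>N. f i (N - i)) sums S"
proof -
  have g: "g i \<ge> 0" for i
    using sums_le[OF _ sums_zero rows[of i]] nonneg by auto
  have rows': "((\<lambda>j. f i j) has_sum g i) UNIV" for i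
    by (rule sums_nonneg_imp_has_sum[OF rows nonneg])
  have total': "(g has_sum S) UNIV"
    by (rule sums_nonneg_imp_has_sum[OF total g])
  have "((\<lambda>(i, j). f i j) has_sum S) (UNIV \<times> UNIV)"
  proof (rule has_sum_SigmaI)
    have "(\<lambda>p. norm (case p of (i, j) \<Rightarrow> f i j)) summable_on (UNIV \<times> UNIV)"
      using infsumI[OF rows'] nonneg rows' total' g
      by (subst Infinite_Sum.abs_summable_on_Sigma_iff) (auto intro: has_sum_imp_summable[OF rows'] has_sum_imp_summable[OF total'])
    thus "(\<lambda>(i, j). f i j) summable_on (UNIV \<times> UNIV)"
      by (rule abs_summable_summable)
  qed (use rows' total' in auto)
  moreover have "bij_betw (\<lambda>(N, i). (i, N - i)) (SIGMA N:UNIV. {..N}) (UNIV \<times> UNIV :: (nat \<times> nat) set)"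
    by (rule bij_betwI[where g = "\<lambda>(i, j). (i + j, i)"]) auto
  ultimately have "((\<lambda>(N, i). f i (N - i)) has_sum S) (SIGMA N:UNIV. {..N})"
    using has_sum_reindex_bij_betw[of "\<lambda>(N, i). (i, N - i)" "SIGMA N:UNIV. {..N}" "UNIV \<times> UNIV" "\<lambda>(i, j). f i j" S]
    by (simp add: case_prod_unfold)
  hence "((\<lambda>N. \<Sum>i\<le>N. f i (N - i)) has_sum S) UNIV"
    by (rule has_sum_SigmaD) (auto intro: has_sum_finite)
  thus ?thesis by (rule has_sum_imp_sums)
qed

text \<open>The difference \<open>harm n - ln n\<close> converges to the Euler-Mascheroni constant,
  so it is bounded and is absorbed by \<open>ln n\<close>.\<close>

lemma harm_bigo: "(harm :: nat \<Rightarrow> real) \<in> O(\<lambda>n. ln (real n))"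
proof -
  have "(\<lambda>n. harm n - ln (real n)) \<in> O(\<lambda>_. 1 :: real)"
    using euler_mascheroni_LIMSEQ by (intro bigoI_tendsto) auto
  also have "(\<lambda>_. 1 :: real) \<in> O(\<lambda>n. ln (real n))" by real_asymp
  finally have "(\<lambda>n. harm n - ln (real n)) \<in> O(\<lambda>n. ln (real n))" .
  from sum_in_bigo(1)[OF this landau_o.big_refl] show ?thesis
    unfolding diff_add_cancel .
qed

lemma summable_harm_squared_powr:
  assumes "\<sigma> > (1 :: real)"
  shows "summable (\<lambda>n. (harm (Suc n))\<^sup>2 / real (Suc n) powr \<sigma>)"
proof -
  have "(\<lambda>n. (harm n)\<^sup>2 / real n powr \<sigma>) \<in> O(\<lambda>n. (ln (real n))\<^sup>2 / real n powr \<sigma>)"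
    by (intro landau_o.big.divide_right landau_o.big_power harm_bigo)
       (auto intro: eventually_sequentiallyI[of 1])
  \<comment> \<open>The exponent \<open>(1 + \<sigma>) / 2\<close> lies strictly between 1 and
    \<open>\<sigma>\<close>: the surplus power absorbs the logarithms and a convergent p-series
    remains.\<close>
  also have "(\<lambda>n. (ln (real n))\<^sup>2 / real n powr \<sigma>) \<in> O(\<lambda>n. real n powr (- (1 + \<sigma>) / 2))"
    using assms by real_asymp
  finally have "summable (\<lambda>n. (harm n)\<^sup>2 / real n powr \<sigma>)"
    using assms by (rule_tac summable_comparison_test_bigo) (auto simp: summable_real_powr_iff)
  thus ?thesis by (subst summable_Suc_iff)
qed

lemma summable_harm_powr:
  assumes "\<sigma> > (1 :: real)"
  shows "summable (\<lambda>n. harm (Suc n) / real (Suc n) powr \<sigma>)"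
proof (rule summable_comparison_test'[OF summable_harm_squared_powr[OF assms], of 0])
  fix n :: nat
  have "(1::real) \<le> harm (Suc n)"
    using harm_mono[of 1 "Suc n", where 'a = real] by (simp add: harm_expand)
  hence "harm (Suc n) \<le> (harm (Suc n) :: real)\<^sup>2"
    using power_increasing[of 1 2 "harm (Suc n) :: real"] by simp
  thus "norm (harm (Suc n) / real (Suc n) powr \<sigma>) \<le> (harm (Suc n))\<^sup>2 / real (Suc n) powr \<sigma>"
    by (simp add: divide_right_mono)
qed

text \<open>Partial fractions turn the term into a difference with lag \<open>Suc i\<close>, which
  telescopes. Read from right to left, this expands a harmonic number into a row of a double
  series.\<close>

lemma sums_inverse_shift:
  "(\<lambda>j. 1 / (real (Suc j) * real (Suc (i + Suc j)))) sums (gen_harm 1 (Suc i) / real (Suc i))"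
proof -
  have *: "(\<lambda>j. 1 / real (Suc j) - 1 / real (Suc (j + n))) sums gen_harm 1 n" for n
  proof (induction n)
    case (Suc n)
    have "(\<lambda>j. 1 / real (Suc (j + n)) - 1 / real (Suc (Suc j + n))) sums (1 / real (Suc (0 + n)) - 0)"
      by (rule telescope_sums') real_asymp
    from sums_add[OF Suc this] show ?case by (simp add: gen_harm_Suc)
  qed auto
  have "1 / (real (Suc j) * real (Suc (i + Suc j))) =
        (1 / real (Suc j) - 1 / real (Suc (j + Suc i))) / real (Suc i)" for j
    by (simp add: divide_simps del: of_nat_Suc) (simp add: algebra_simps)
  thus ?thesis using sums_divide[OF *[of "Suc i"], of "real (Suc i)"] by simp
qed

section \<open>Finite harmonic sums over antidiagonals\<close>

lemma gen_harm_Suc_atMost_rev: "(\<Sum>i\<le>N. 1 / of_nat (Suc (N - i)) ^ r) = gen_harm r (Suc N)"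
  using sum.nat_diff_reindex[of "\<lambda>i. 1 / of_nat (Suc i) ^ r" "Suc N"]
  by (simp add: gen_harm_altdef lessThan_Suc_atMost del: of_nat_Suc)

lemma gen_harm_Suc_atMost: "(\<Sum>i\<le>N. 1 / of_nat (Suc i) ^ r) = gen_harm r (Suc N)"
  by (simp add: gen_harm_altdef lessThan_Suc_atMost del: of_nat_Suc)

text \<open>The left side adds 1/(j k) over pairs j \<le> k \<le> N. The square counts each
  off-diagonal pair twice and the diagonal once; \<open>gen_harm 2 N\<close> supplies the second
  copy of the diagonal.\<close>

lemma sum_gen_harm_over_index:
  "(\<Sum>i<N. gen_harm 1 (Suc i) / real (Suc i)) = ((gen_harm 1 N)\<^sup>2 + gen_harm 2 N) / 2"
  by (induction N) (simp_all add: gen_harm_Suc field_simps power2_eq_square del: of_nat_Suc)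

lemma sum_inverse_antidiagonal:
  "(\<Sum>i\<le>N. 1 / (real (Suc i) * real (Suc (N - i)))) = 2 * gen_harm 1 (Suc N) / real (N + 2)"
proof -
  have "(\<Sum>i\<le>N. 1 / (real (Suc i) * real (Suc (N - i)))) =
        (\<Sum>i\<le>N. (1 / real (Suc i) ^ 1 + 1 / real (Suc (N - i)) ^ 1) / real (N + 2))"
  proof (rule sum.cong)
    fix i assume "i \<in> {..N}"
    hence eq: "real (N + 2) = real (Suc i) + real (Suc (N - i))" by (simp add: of_nat_diff)
    show "1 / (real (Suc i) * real (Suc (N - i))) =
            (1 / real (Suc i) ^ 1 + 1 / real (Suc (N - i)) ^ 1) / real (N + 2)"
      unfolding eq by (simp add: divide_simps)
  qed auto
  also have "\<dots> = 2 * gen_harm 1 (Suc N) / real (N + 2)"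
    unfolding sum_divide_distrib [symmetric] sum.distrib gen_harm_Suc_atMost_rev gen_harm_Suc_atMost by simp
  finally show ?thesis .
qed

text \<open>The left side adds 1/(j k) over j, k \<ge> 1 with j + k \<le> N + 1. Each induction step
  adds one further antidiagonal, j + k = N + 2, which is the preceding lemma; the last summand of
  the longer sum vanishes because it contains \<open>gen_harm 1 0\<close>.\<close>

lemma sum_gen_harm_antidiagonal:
  "(\<Sum>i\<le>N. gen_harm 1 (N - i) / real (Suc i)) = (gen_harm 1 (Suc N))\<^sup>2 - gen_harm 2 (Suc N)"
proof (induction N)
  case 0
  thus ?case by (simp add: gen_harm_def)
next
  case (Suc N)
  have "(\<Sum>i\<le>Suc N. gen_harm 1 (Suc N - i) / real (Suc i)) =
        (\<Sum>i\<le>N. gen_harm 1 (N - i) / real (Suc i) + 1 / (real (Suc i) * real (Suc (N - i))))"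
    by (auto simp: Suc_diff_le gen_harm_Suc add_divide_distrib mult.commute intro!: sum.cong)
  also have "\<dots> = (gen_harm 1 (Suc N))\<^sup>2 - gen_harm 2 (Suc N) + 2 * gen_harm 1 (Suc N) / real (N + 2)"
    by (simp only: sum.distrib Suc sum_inverse_antidiagonal)
  also have "\<dots> = (gen_harm 1 (Suc (Suc N)))\<^sup>2 - gen_harm 2 (Suc (Suc N))"
    unfolding gen_harm_Suc[of _ "Suc N"] by (simp add: power2_sum power_divide)
  finally show ?case .
qed

section \<open>Zeta values and the relations in weight 4\<close>

lemma zeta_eq_suminf: "zeta (of_nat k) = (\<Sum>n. 1 / real (Suc n) ^ k)"
  by (simp add: zeta_def powr_realpow del: of_nat_Suc)

lemma sums_zeta: "k \<ge> 2 \<Longrightarrow> (\<lambda>n. 1 / real (Suc n) ^ k) sums zeta (of_nat k)"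
  unfolding zeta_eq_suminf using inverse_power_summable[of k, where 'a = real]
  by (intro summable_sums, subst summable_Suc_iff) (simp add: divide_inverse)

lemma zeta_2: "zeta 2 = pi\<^sup>2 / 6"
  using inverse_squares_sums sums_zeta[of 2] by (simp add: sums_iff add.commute)

text \<open>
  \<open>z31\<close> and \<open>z22\<close> are the double zeta values \<open>\<zeta>(3,1)\<close> and \<open>\<zeta>(2,2)\<close>: the inner index runs below the
  outer index \<open>Suc n\<close>. The relations come from summing along antidiagonals, with partial fractions,
  a positive double series whose rows are known.
\<close>

context
  fixes z31 z22 hh :: real
  defines "z31 \<equiv> (\<Sum>n. gen_harm 1 n / real (Suc n) ^ 3)"
      and "z22 \<equiv> (\<Sum>n. gen_harm 2 n / (real (Suc n))\<^sup>2)"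
      and "hh \<equiv> (\<Sum>n. (gen_harm 1 n)\<^sup>2 / (real (Suc n))\<^sup>2)"
begin

lemma sums_z31: "(\<lambda>n. gen_harm 1 n / real (Suc n) ^ 3) sums z31"
proof -
  have "summable (\<lambda>n. gen_harm 1 (Suc n) / real (Suc n) ^ 3 - 1 / real (Suc n) ^ 4)"
    using summable_harm_powr[of 3] sums_zeta[of 4]
    by (intro summable_diff) (auto simp: gen_harm_1_eq_harm powr_realpow sums_iff simp del: of_nat_Suc)
  also have "(\<lambda>n. gen_harm 1 (Suc n) / real (Suc n) ^ 3 - 1 / real (Suc n) ^ 4) =
             (\<lambda>n. gen_harm 1 n / real (Suc n) ^ 3)"
    by (simp add: gen_harm_Suc add_divide_distrib numeral_eq_Suc mult_ac del: of_nat_Suc)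
  finally show ?thesis unfolding z31_def by (rule summable_sums)
qed

lemma euler_sum_1_3: "(\<lambda>n. gen_harm 1 (Suc n) / real (Suc n) ^ 3) sums (z31 + zeta 4)"
proof -
  have "(\<lambda>n. gen_harm 1 n / real (Suc n) ^ 3 + 1 / real (Suc n) ^ 4) sums (z31 + zeta 4)"
    using sums_zeta[of 4] by (intro sums_add sums_z31) auto
  also have "(\<lambda>n. gen_harm 1 n / real (Suc n) ^ 3 + 1 / real (Suc n) ^ 4) =
             (\<lambda>n. gen_harm 1 (Suc n) / real (Suc n) ^ 3)"
    by (simp add: gen_harm_Suc add_divide_distrib numeral_eq_Suc mult_ac del: of_nat_Suc)
  finally show ?thesis .
qed

text \<open>Telescoping the squares of the partial sums of zeta(2): each increment is twice the
  off-diagonal term plus the diagonal term \<open>1 / Suc n ^ 4\<close>.\<close>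

lemma stuffle_2_2: "(\<lambda>n. gen_harm 2 n / (real (Suc n))\<^sup>2) sums (((zeta 2)\<^sup>2 - zeta 4) / 2)"
proof -
  have "gen_harm 2 \<longlonglongrightarrow> (zeta 2 :: real)"
    using sums_zeta[of 2] by (simp add: sums_def gen_harm_altdef[abs_def] del: of_nat_Suc)
  hence "(\<lambda>n. (gen_harm 2 n)\<^sup>2) \<longlonglongrightarrow> (zeta 2 :: real)\<^sup>2"
    by (intro tendsto_power)
  from telescope_sums[OF this]
  have "(\<lambda>n. (gen_harm 2 (Suc n))\<^sup>2 - (gen_harm 2 n)\<^sup>2) sums (zeta 2 :: real)\<^sup>2"
    by simp
  from sums_divide[OF sums_diff[OF this sums_zeta[of 4]], of 2]
  have "(\<lambda>n. gen_harm 2 n / (real (Suc n))\<^sup>2) sums (((zeta 2)\<^sup>2 - zeta (of_nat 4)) / 2)"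
    by (simp add: gen_harm_Suc power2_eq_square field_simps numeral_eq_Suc del: of_nat_Suc)
  thus ?thesis by simp
qed

lemma sums_z22: "(\<lambda>n. gen_harm 2 n / (real (Suc n))\<^sup>2) sums z22"
  using stuffle_2_2 by (simp add: z22_def sums_iff)

text \<open>In the product series of 1/(a^2 b^2) the sum a + b is constant on an antidiagonal. The
  partial fractions \<open>pf\<close> leave only powers of a alone or of b alone over powers of a +
  b, so each antidiagonal becomes a combination of harmonic numbers.\<close>

lemma shuffle_2_2: "(zeta 2)\<^sup>2 = 2 * z22 + 4 * z31"
proof -
  have "(\<lambda>N. \<Sum>i\<le>N. 1 / (real (Suc i) ^ 2 * real (Suc (N - i)) ^ 2)) sums (zeta 2)\<^sup>2"
  proof (rule nonneg_rows_sums_diagonals)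
    show "(\<lambda>j. 1 / (real (Suc i) ^ 2 * real (Suc j) ^ 2)) sums (1 / real (Suc i) ^ 2 * zeta 2)" for i
      using sums_mult[OF sums_zeta[of 2], of "1 / real (Suc i) ^ 2"] by simp
    show "(\<lambda>i. 1 / real (Suc i) ^ 2 * zeta 2) sums (zeta 2)\<^sup>2"
      using sums_mult2[OF sums_zeta[of 2], of "zeta 2"] by (simp add: power2_eq_square)
  qed auto
  also have "(\<lambda>N. \<Sum>i\<le>N. 1 / (real (Suc i) ^ 2 * real (Suc (N - i)) ^ 2)) =
    (\<lambda>N. 2 * (gen_harm 2 (Suc N) / (real (Suc (Suc N)))\<^sup>2) + 4 * (gen_harm 1 (Suc N) / real (Suc (Suc N)) ^ 3))"
  proof
    fix N
    have "1 / (a ^ 2 * b ^ 2) = (1 / a ^ 2 + 1 / b ^ 2) / (a + b) ^ 2 + 2 * (1 / a ^ 1 + 1 / b ^ 1) / (a + b) ^ 3"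
      if "a > 0" "b > 0" for a b :: real
    proof -
      have "a + b > 0" using that by simp
      with that show ?thesis
        by (simp add: divide_simps power2_eq_square power3_eq_cube) (simp add: algebra_simps)
    qed
    note pf = this
    have "(\<Sum>i\<le>N. 1 / (real (Suc i) ^ 2 * real (Suc (N - i)) ^ 2)) =
          (\<Sum>i\<le>N. (1 / real (Suc i) ^ 2 + 1 / real (Suc (N - i)) ^ 2) / real (Suc (Suc N)) ^ 2 +
            2 * (1 / real (Suc i) ^ 1 + 1 / real (Suc (N - i)) ^ 1) / real (Suc (Suc N)) ^ 3)"
    proof (rule sum.cong)
      fix i assume "i \<in> {..N}"
      hence "real (Suc (Suc N)) = real (Suc i) + real (Suc (N - i))" by (simp add: of_nat_diff)
      thus "1 / (real (Suc i) ^ 2 * real (Suc (N - i)) ^ 2) =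
            (1 / real (Suc i) ^ 2 + 1 / real (Suc (N - i)) ^ 2) / real (Suc (Suc N)) ^ 2 +
            2 * (1 / real (Suc i) ^ 1 + 1 / real (Suc (N - i)) ^ 1) / real (Suc (Suc N)) ^ 3"
        using pf[of "real (Suc i)" "real (Suc (N - i))"] by (simp del: of_nat_Suc)
    qed auto
    thus "(\<Sum>i\<le>N. 1 / (real (Suc i) ^ 2 * real (Suc (N - i)) ^ 2)) =
       2 * (gen_harm 2 (Suc N) / (real (Suc (Suc N)))\<^sup>2) + 4 * (gen_harm 1 (Suc N) / real (Suc (Suc N)) ^ 3)"
      unfolding sum_divide_distrib [symmetric] sum_distrib_left [symmetric] sum.distrib gen_harm_Suc_atMost_rev gen_harm_Suc_atMost
      by simp
  qed
  finally have "(\<lambda>N. 2 * (gen_harm 2 (Suc N) / (real (Suc (Suc N)))\<^sup>2) +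
      4 * (gen_harm 1 (Suc N) / real (Suc (Suc N)) ^ 3)) sums (zeta 2)\<^sup>2" .
  \<comment> \<open>Antidiagonals begin at a + b = 2, the double zeta series at outer index 1. The
    prepended term is 0 since \<open>gen_harm\<close> vanishes at 0.\<close>
  from this[THEN sums_Suc[where f = "\<lambda>N. 2 * (gen_harm 2 N / (real (Suc N))\<^sup>2) + 4 * (gen_harm 1 N / real (Suc N) ^ 3)"]]
  have "(\<lambda>N. 2 * (gen_harm 2 N / (real (Suc N))\<^sup>2) + 4 * (gen_harm 1 N / real (Suc N) ^ 3)) sums (zeta 2)\<^sup>2"
    by simp
  thus ?thesis
    by (rule sums_unique2) (intro sums_add sums_mult sums_z31 sums_z22)
qed

text \<open>Two evaluations of the double series of 1/(a^2 b (a + b)): rows give the sum of H_a /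
  a^3 by \<open>sums_inverse_shift\<close>, antidiagonals give the right side. Cancelling
  \<open>z31\<close> leaves Euler's zeta(4) = zeta(3,1) + zeta(2,2).\<close>

lemma sum_formula_weight_4: "z31 + zeta 4 = z22 + 2 * z31"
proof -
  have "(\<lambda>N. \<Sum>i\<le>N. 1 / real (Suc i) ^ 2 * (1 / (real (Suc (N - i)) * real (Suc (i + Suc (N - i))))))
          sums (z31 + zeta 4)"
  proof (rule nonneg_rows_sums_diagonals)
    show "(\<lambda>j. 1 / real (Suc i) ^ 2 * (1 / (real (Suc j) * real (Suc (i + Suc j))))) sums
            (gen_harm 1 (Suc i) / real (Suc i) ^ 3)" for i
      using sums_mult[OF sums_inverse_shift[of i], of "1 / real (Suc i) ^ 2"]
      by (simp add: numeral_eq_Suc mult_ac del: of_nat_Suc)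
  qed (use euler_sum_1_3 in auto)
  also have "(\<lambda>N. \<Sum>i\<le>N. 1 / real (Suc i) ^ 2 * (1 / (real (Suc (N - i)) * real (Suc (i + Suc (N - i)))))) =
    (\<lambda>N. gen_harm 2 (Suc N) / (real (Suc (Suc N)))\<^sup>2 + 2 * (gen_harm 1 (Suc N) / real (Suc (Suc N)) ^ 3))"
  proof
    fix N
    have "1 / a ^ 2 * (1 / (b * (a + b))) = 1 / a ^ 2 / (a + b) ^ 2 + (1 / a ^ 1 + 1 / b ^ 1) / (a + b) ^ 3"
      if "a > 0" "b > 0" for a b :: real
    proof -
      have "a + b > 0" using that by simp
      with that show ?thesis
        by (simp add: divide_simps power2_eq_square power3_eq_cube) (simp add: algebra_simps)
    qed
    note pf = this
    have "(\<Sum>i\<le>N. 1 / real (Suc i) ^ 2 * (1 / (real (Suc (N - i)) * real (Suc (i + Suc (N - i)))))) =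
          (\<Sum>i\<le>N. 1 / real (Suc i) ^ 2 / real (Suc (Suc N)) ^ 2 +
            (1 / real (Suc i) ^ 1 + 1 / real (Suc (N - i)) ^ 1) / real (Suc (Suc N)) ^ 3)"
    proof (rule sum.cong)
      fix i assume "i \<in> {..N}"
      hence eq: "real (Suc (Suc N)) = real (Suc i) + real (Suc (N - i))"
            "Suc (i + Suc (N - i)) = Suc (Suc N)" by (simp_all add: of_nat_diff)
      show "1 / real (Suc i) ^ 2 * (1 / (real (Suc (N - i)) * real (Suc (i + Suc (N - i))))) =
            1 / real (Suc i) ^ 2 / real (Suc (Suc N)) ^ 2 +
            (1 / real (Suc i) ^ 1 + 1 / real (Suc (N - i)) ^ 1) / real (Suc (Suc N)) ^ 3"
        unfolding eq by (rule pf) auto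
    qed auto
    thus "(\<Sum>i\<le>N. 1 / real (Suc i) ^ 2 * (1 / (real (Suc (N - i)) * real (Suc (i + Suc (N - i)))))) =
       gen_harm 2 (Suc N) / (real (Suc (Suc N)))\<^sup>2 + 2 * (gen_harm 1 (Suc N) / real (Suc (Suc N)) ^ 3)"
      unfolding sum_divide_distrib [symmetric] sum_distrib_left [symmetric] sum.distrib gen_harm_Suc_atMost_rev gen_harm_Suc_atMost
      by simp
  qed
  finally have "(\<lambda>N. gen_harm 2 (Suc N) / (real (Suc (Suc N)))\<^sup>2 +
      2 * (gen_harm 1 (Suc N) / real (Suc (Suc N)) ^ 3)) sums (z31 + zeta 4)" .
  from this[THEN sums_Suc[where f = "\<lambda>N. gen_harm 2 N / (real (Suc N))\<^sup>2 + 2 * (gen_harm 1 N / real (Suc N) ^ 3)"]]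
  have "(\<lambda>N. gen_harm 2 N / (real (Suc N))\<^sup>2 + 2 * (gen_harm 1 N / real (Suc N) ^ 3)) sums (z31 + zeta 4)"
    by simp
  thus ?thesis
    by (rule sums_unique2) (intro sums_add sums_mult sums_z31 sums_z22)
qed

lemma sums_hh: "(\<lambda>n. (gen_harm 1 n)\<^sup>2 / (real (Suc n))\<^sup>2) sums hh"
  and euler_sum_11_2: "(\<lambda>n. (gen_harm 1 (Suc n))\<^sup>2 / (real (Suc n))\<^sup>2) sums (hh + 2 * z31 + zeta 4)"
proof -
  have eq: "(\<lambda>n. (gen_harm 1 (Suc n))\<^sup>2 / (real (Suc n))\<^sup>2) = (\<lambda>n. (gen_harm 1 n)\<^sup>2 / (real (Suc n))\<^sup>2 +
          2 * (gen_harm 1 n / real (Suc n) ^ 3) + 1 / real (Suc n) ^ 4)"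
    by (simp add: gen_harm_Suc power2_eq_square numeral_eq_Suc field_simps del: of_nat_Suc)
  have *: "(\<lambda>n. 2 * (gen_harm 1 n / real (Suc n) ^ 3) + 1 / real (Suc n) ^ 4) sums (2 * z31 + zeta 4)"
    using sums_zeta[of 4] by (intro sums_add sums_mult sums_z31) auto
  have "summable (\<lambda>n. (gen_harm 1 (Suc n))\<^sup>2 / (real (Suc n))\<^sup>2)"
    using summable_harm_squared_powr[of 2] by (simp add: gen_harm_1_eq_harm powr_realpow del: of_nat_Suc)
  from summable_diff[OF this[unfolded eq] sums_summable[OF *]]
  show hh: "(\<lambda>n. (gen_harm 1 n)\<^sup>2 / (real (Suc n))\<^sup>2) sums hh"
    unfolding hh_def by (intro summable_sums) (simp add: algebra_simps del: of_nat_Suc)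
  show "(\<lambda>n. (gen_harm 1 (Suc n))\<^sup>2 / (real (Suc n))\<^sup>2) sums (hh + 2 * z31 + zeta 4)"
    unfolding eq using sums_add[OF hh *] by (simp add: add_ac)
qed

text \<open>Let S be the sum of H_n^2 / n^2. Its row expansion has terms H_a / (a b (a + b)). With M
  = a + b, the antidiagonal sum splits into the sums of H_a / a and of H_a / b, both over M^2; the
  second produces H_M^2 / M^2 and hence S again. S cancels from both sides, and what remains
  determines \<open>hh\<close>.\<close>

lemma hh_eq: "hh = z22 + 2 * zeta 4"
proof -
  let ?M = "\<lambda>N. real (Suc (Suc N))"
  have "(\<lambda>N. \<Sum>i\<le>N. gen_harm 1 (Suc i) / real (Suc i) * (1 / (real (Suc (N - i)) * real (Suc (i + Suc (N - i))))))
          sums (hh + 2 * z31 + zeta 4)"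
  proof (rule nonneg_rows_sums_diagonals)
    show "(\<lambda>j. gen_harm 1 (Suc i) / real (Suc i) * (1 / (real (Suc j) * real (Suc (i + Suc j))))) sums
            ((gen_harm 1 (Suc i))\<^sup>2 / (real (Suc i))\<^sup>2)" for i
      using sums_mult[OF sums_inverse_shift[of i], of "gen_harm 1 (Suc i) / real (Suc i)"]
      by (simp add: power2_eq_square del: of_nat_Suc)
  qed (use euler_sum_11_2 gen_harm_nonneg in auto)
  also have "(\<lambda>N. \<Sum>i\<le>N. gen_harm 1 (Suc i) / real (Suc i) * (1 / (real (Suc (N - i)) * real (Suc (i + Suc (N - i)))))) =
    (\<lambda>N. ((gen_harm 1 (Suc N))\<^sup>2 / ?M N ^ 2 + gen_harm 2 (Suc N) / ?M N ^ 2) / 2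
         + (gen_harm 1 (Suc (Suc N)))\<^sup>2 / ?M N ^ 2 - (gen_harm 2 (Suc N) / ?M N ^ 2 + 1 / ?M N ^ 4))"
  proof
    fix N
    have "h / a * (1 / (b * (a + b))) = (h / a + h / b) / (a + b) ^ 2"
      if "a > 0" "b > 0" for a b h :: real
    proof -
      have "a + b > 0" using that by simp
      with that show ?thesis
        by (simp add: divide_simps power2_eq_square) (simp add: algebra_simps)
    qed
    note pf = this
    have rev: "(\<Sum>i\<le>N. gen_harm 1 (Suc i) / real (Suc (N - i))) = (gen_harm 1 (Suc (Suc N)))\<^sup>2 - gen_harm 2 (Suc (Suc N))"
    proof -
      have "(\<Sum>i\<le>N. gen_harm 1 (Suc i) / real (Suc (N - i))) = (\<Sum>i\<le>N. gen_harm 1 (Suc N - i) / real (Suc i))"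
        using sum.nat_diff_reindex[of "\<lambda>i. gen_harm 1 (Suc i) / real (Suc (N - i))" "Suc N"]
        by (auto simp: lessThan_Suc_atMost Suc_diff_le simp del: of_nat_Suc intro!: sum.cong)
      \<comment> \<open>The extra summand is \<open>gen_harm 1 0 / real (Suc (Suc N)) = 0\<close>;
        it completes the sum to the form of \<open>sum_gen_harm_antidiagonal\<close> at
        \<open>Suc N\<close>.\<close>
      also have "\<dots> = (\<Sum>i\<le>Suc N. gen_harm 1 (Suc N - i) / real (Suc i))"
        by simp
      finally show ?thesis by (simp only: sum_gen_harm_antidiagonal)
    qed
    have "(\<Sum>i\<le>N. gen_harm 1 (Suc i) / real (Suc i) * (1 / (real (Suc (N - i)) * real (Suc (i + Suc (N - i)))))) =
          (\<Sum>i\<le>N. (gen_harm 1 (Suc i) / real (Suc i) + gen_harm 1 (Suc i) / real (Suc (N - i))) / ?M N ^ 2)"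
    proof (rule sum.cong)
      fix i assume "i \<in> {..N}"
      hence eq: "?M N = real (Suc i) + real (Suc (N - i))"
            "Suc (i + Suc (N - i)) = Suc (Suc N)" by (simp_all add: of_nat_diff)
      show "gen_harm 1 (Suc i) / real (Suc i) * (1 / (real (Suc (N - i)) * real (Suc (i + Suc (N - i))))) =
            (gen_harm 1 (Suc i) / real (Suc i) + gen_harm 1 (Suc i) / real (Suc (N - i))) / ?M N ^ 2"
        unfolding eq by (rule pf) auto
    qed auto
    also have "\<dots> = (((gen_harm 1 (Suc N))\<^sup>2 + gen_harm 2 (Suc N)) / 2 
        + ((gen_harm 1 (Suc (Suc N)))\<^sup>2 - gen_harm 2 (Suc (Suc N)))) / ?M N ^ 2"
      unfolding sum_divide_distrib [symmetric] sum.distrib rev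
      using sum_gen_harm_over_index[of "Suc N"] by (simp only: lessThan_Suc_atMost)
    also have "\<dots> = ((gen_harm 1 (Suc N))\<^sup>2 / ?M N ^ 2 + gen_harm 2 (Suc N) / ?M N ^ 2) / 2
         + (gen_harm 1 (Suc (Suc N)))\<^sup>2 / ?M N ^ 2 - (gen_harm 2 (Suc N) / ?M N ^ 2 + 1 / ?M N ^ 4)"
      unfolding gen_harm_Suc[of 2 "Suc N"]
      by (simp add: diff_divide_distrib add_divide_distrib numeral_eq_Suc mult_ac del: of_nat_Suc)
    finally show "(\<Sum>i\<le>N. gen_harm 1 (Suc i) / real (Suc i) * (1 / (real (Suc (N - i)) * real (Suc (i + Suc (N - i)))))) = \<dots>" .
  qed
  finally have "(\<lambda>N. ((gen_harm 1 (Suc N))\<^sup>2 / ?M N ^ 2 + gen_harm 2 (Suc N) / ?M N ^ 2) / 2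
         + (gen_harm 1 (Suc (Suc N)))\<^sup>2 / ?M N ^ 2 - (gen_harm 2 (Suc N) / ?M N ^ 2 + 1 / ?M N ^ 4)) sums (hh + 2 * z31 + zeta 4)" .
  \<comment> \<open>Here the prepended term is not termwise zero: at index 0 it equals 1 - 1, from
    H_1^2 and from \<open>1 / real (Suc 0) ^ 4\<close>.\<close>
  from this[THEN sums_Suc[where f = "\<lambda>N. ((gen_harm 1 N)\<^sup>2 / real (Suc N) ^ 2 + gen_harm 2 N / real (Suc N) ^ 2) / 2
         + (gen_harm 1 (Suc N))\<^sup>2 / real (Suc N) ^ 2 - (gen_harm 2 N / real (Suc N) ^ 2 + 1 / real (Suc N) ^ 4)"]]
  have "(\<lambda>N. ((gen_harm 1 N)\<^sup>2 / real (Suc N) ^ 2 + gen_harm 2 N / real (Suc N) ^ 2) / 2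
         + (gen_harm 1 (Suc N))\<^sup>2 / real (Suc N) ^ 2 - (gen_harm 2 N / real (Suc N) ^ 2 + 1 / real (Suc N) ^ 4))
       sums (hh + 2 * z31 + zeta 4)" by (simp add: gen_harm_def)
  moreover have "(\<lambda>N. ((gen_harm 1 N)\<^sup>2 / real (Suc N) ^ 2 + gen_harm 2 N / real (Suc N) ^ 2) / 2
         + (gen_harm 1 (Suc N))\<^sup>2 / real (Suc N) ^ 2 - (gen_harm 2 N / real (Suc N) ^ 2 + 1 / real (Suc N) ^ 4))
       sums ((hh + z22) / 2 + (hh + 2 * z31 + zeta 4) - (z22 + zeta 4))"
    using sums_zeta[of 4]
    by (intro sums_add sums_diff sums_divide sums_hh sums_z22 euler_sum_11_2) auto
  ultimately have "hh + 2 * z31 + zeta 4 = (hh + z22) / 2 + (hh + 2 * z31 + zeta 4) - (z22 + zeta 4)"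
    by (rule sums_unique2)
  thus ?thesis by simp
qed

lemma z22_eq: "z22 = ((zeta 2)\<^sup>2 - zeta 4) / 2"
  using sums_unique2[OF sums_z22 stuffle_2_2] .

text \<open>Stuffle against shuffle gives z31 = zeta(4)/4, then the sum formula gives z22 = 3/4
  zeta(4), and the stuffle relation yields 3/2 + 1 = 5/2.\<close>

lemma zeta_2_squared: "(zeta 2 :: real)\<^sup>2 = 5 / 2 * zeta 4"
  using z22_eq shuffle_2_2 sum_formula_weight_4 by (simp add: field_simps)

lemma sums_harm_over_cube: "(\<lambda>n. gen_harm 1 (Suc n) / real (Suc n) ^ 3) sums (5 / 4 * zeta 4)"
  using z22_eq shuffle_2_2 sum_formula_weight_4 euler_sum_1_3 by (simp add: field_simps)

text \<open>The constant is 11/4 from \<open>hh\<close>, 1/2 from \<open>2 * z31\<close> and 1 from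
  the diagonal.\<close>

lemma sums_harm_squared_over_square:
  "(\<lambda>n. (gen_harm 1 (Suc n))\<^sup>2 / (real (Suc n))\<^sup>2) sums (17 / 4 * zeta 4)"
proof -
  have "hh + 2 * z31 + zeta 4 = 17 / 4 * zeta 4"
    using z22_eq shuffle_2_2 sum_formula_weight_4 hh_eq by (simp add: field_simps)
  with euler_sum_11_2 show ?thesis by simp
qed

end

lemma zeta_4: "zeta 4 = pi ^ 4 / 90"
  using zeta_2_squared by (simp add: zeta_2 power_divide)

subsection \<open>Abel's inequality and Abel's theorem\<close>

text \<open>Summation by parts shifts the differences onto \<open>b\<close>. They are nonnegative,
  and together with the boundary weight \<open>b k\<close> they add up to
  \<open>b 0\<close>.\<close>

lemma abel_inequality:
  fixes a :: "nat \<Rightarrow> 'a :: real_normed_vector" and b :: "nat \<Rightarrow> real"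
  assumes decr: "\<And>i. b (Suc i) \<le> b i" and nonneg: "\<And>i. b i \<ge> 0"
    and bound: "\<And>k. norm (\<Sum>i<k. a i) \<le> e"
  shows "norm (\<Sum>i<k. b i *\<^sub>R a i) \<le> b 0 * e"
proof -
  have "(\<Sum>i<k. b i *\<^sub>R a i) =
        (\<Sum>i<k. (b i - b (Suc i)) *\<^sub>R (\<Sum>j<Suc i. a j)) + b k *\<^sub>R (\<Sum>j<k. a j)"
    by (induction k) (simp_all add: algebra_simps)
  also have "norm \<dots> \<le> (\<Sum>i<k. (b i - b (Suc i)) * e) + b k * e"
    by (intro norm_triangle_mono order.trans[OF norm_sum] sum_mono)
       (auto simp del: sum.lessThan_Suc intro!: mult_left_mono bound simp: decr nonneg)
  also have "\<dots> = b 0 * e"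
    unfolding sum_distrib_right [symmetric] sum_lessThan_telescope' by (simp add: left_diff_distrib)
  finally show ?thesis .
qed

lemma sum_shift: "(\<Sum>i<k. f (m + i)) = sum f {m..<m+k}" for k m :: nat
  by (induction k) auto

text \<open>Cauchy's criterion with start, length and a non-strict bound: the shape that
  \<open>abel_inequality\<close> consumes and produces.\<close>

lemma summable_iff_small_segments:
  fixes a :: "nat \<Rightarrow> 'a :: banach"
  shows "summable a \<longleftrightarrow> (\<forall>e>0. \<exists>M. \<forall>m\<ge>M. \<forall>k. norm (\<Sum>i<k. a (m + i)) \<le> e)"
proof
  assume *: "\<forall>e>0. \<exists>M. \<forall>m\<ge>M. \<forall>k. norm (\<Sum>i<k. a (m + i)) \<le> e"
  show "summable a"
    unfolding summable_Cauchy
  proof safe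
    fix e :: real assume "e > 0"
    with * obtain M where M: "\<And>m k. m \<ge> M \<Longrightarrow> norm (\<Sum>i<k. a (m + i)) \<le> e / 2"
      by (meson half_gt_zero)
    have "norm (sum a {m..<n}) < e" if "m \<ge> M" for m n
    proof (cases "m \<le> n")
      case True
      thus ?thesis using M[OF that, of "n - m"] \<open>e > 0\<close> by (simp add: sum_shift)
    qed (use \<open>e > 0\<close> in auto)
    thus "\<exists>N. \<forall>m\<ge>N. \<forall>n. norm (sum a {m..<n}) < e" by blast
  qed
qed (auto simp: summable_Cauchy sum_shift intro: less_imp_le, meson less_imp_le)

text \<open>For every \<open>t\<close> in [0, 1] the weights \<open>t ^ (m + i)\<close> decrease in
  \<open>i\<close> and are at most 1, so Abel's inequality bounds all segments uniformly up to and
  including \<open>t = 1\<close>, even if \<open>a\<close> is only conditionally summable.\<close>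

lemma abel_uniform_convergence:
  fixes a :: "nat \<Rightarrow> 'a :: banach"
  assumes "summable a"
  shows "uniformly_convergent_on {0..1} (\<lambda>N t. \<Sum>n<N. (t :: real) ^ n *\<^sub>R a n)"
proof (intro Cauchy_uniformly_convergent uniformly_Cauchy_onI')
  fix e :: real assume "e > 0"
  then obtain M where M: "\<And>m k. m \<ge> M \<Longrightarrow> norm (\<Sum>i<k. a (m + i)) \<le> e / 2"
    using assms unfolding summable_iff_small_segments by (meson half_gt_zero)
  have "dist (\<Sum>n<m. t ^ n *\<^sub>R a n) (\<Sum>n<n. t ^ n *\<^sub>R a n) < e"
    if t: "t \<in> {0..1}" and mn: "m \<ge> M" "n > m" for t m n
  proof -
    have "norm (\<Sum>i<n-m. t ^ (m + i) *\<^sub>R a (m + i)) \<le> t ^ (m + 0) * (e / 2)"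
      by (rule abel_inequality) (use t M mn in \<open>auto intro!: mult_left_le_one_le\<close>)
    also have "\<dots> \<le> 1 * (e / 2)"
      using t \<open>e > 0\<close> by (intro mult_right_mono) (auto intro: power_le_one)
    also have "(\<Sum>i<n-m. t ^ (m + i) *\<^sub>R a (m + i)) = (\<Sum>n=m..<n. t ^ n *\<^sub>R a n)"
      using sum_shift[of "\<lambda>n. t ^ n *\<^sub>R a n" m "n - m"] mn by simp
    also have "\<dots> = (\<Sum>n<n. t ^ n *\<^sub>R a n) - (\<Sum>n<m. t ^ n *\<^sub>R a n)"
      using mn by (simp add: sum_diff_nat_ivl lessThan_atLeast0)
    finally show ?thesis using \<open>e > 0\<close> by (simp add: dist_norm norm_minus_commute)
  qed
  thus "\<exists>M. \<forall>x\<in>{0..1}. \<forall>m\<ge>M. \<forall>n>m. dist (\<Sum>n<m. x ^ n *\<^sub>R a n) (\<Sum>n<n. x ^ n *\<^sub>R a n) < e"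
    by blast
qed

lemma abel_summable:
  fixes a :: "nat \<Rightarrow> 'a :: banach"
  assumes "summable a" "t \<in> {0..1 :: real}"
  shows "summable (\<lambda>n. t ^ n *\<^sub>R a n)"
  using uniformly_convergent_imp_convergent[OF abel_uniform_convergence[OF assms(1)] assms(2)]
  by (simp add: summable_iff_convergent)

lemma abel_continuous_on:
  fixes a :: "nat \<Rightarrow> 'a :: banach"
  assumes "summable a"
  shows "continuous_on {0..1} (\<lambda>t :: real. \<Sum>n. t ^ n *\<^sub>R a n)"
proof (rule uniform_limit_theorem)
  show "uniform_limit {0..1} (\<lambda>N t. \<Sum>n<N. t ^ n *\<^sub>R a n) (\<lambda>t :: real. \<Sum>n. t ^ n *\<^sub>R a n) sequentially"
    using abel_uniform_convergence[OF assms]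
    by (simp add: uniformly_convergent_uniform_limit_iff suminf_eq_lim)
qed (auto intro!: always_eventually continuous_intros)

text \<open>Abel's inequality with the decreasing weights \<open>1 / w n\<close> applied to the series of \<open>w n *\<^sub>R a n\<close>.\<close>

lemma summable_weighted_tail:
  fixes a :: "nat \<Rightarrow> 'a :: banach" and w :: "nat \<Rightarrow> real"
  assumes summable: "summable (\<lambda>n. w n *\<^sub>R a n)"
    and pos: "\<And>n. w n > 0" and incr: "\<And>n. w n \<le> w (Suc n)"
  shows "summable a" "(\<lambda>N. w N *\<^sub>R (\<Sum>n. a (n + N))) \<longlonglongrightarrow> 0"
proof -
  have nz: "w n \<noteq> 0" for n
    using pos[of n] by simp
  have inv: "1 / w (Suc n) \<le> 1 / w n" "1 / w n \<ge> 0" for n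
    using pos[of n] pos[of "Suc n"] incr[of n] by (auto simp: field_simps)
  \<comment> \<open>The factor \<open>1 / w m\<close> serves both claims: it is at most
    \<open>1 / w 0\<close>, and in the limit it pays for the factor \<open>w N\<close> before the
    tail.\<close>
  have *: "\<exists>M. \<forall>m\<ge>M. \<forall>k. norm (\<Sum>i<k. a (m + i)) \<le> e / w m" if e: "e > 0" for e
  proof -
    from e summable obtain M where M: "\<And>m k. m \<ge> M \<Longrightarrow> norm (\<Sum>i<k. w (m + i) *\<^sub>R a (m + i)) \<le> e"
      unfolding summable_iff_small_segments by metis
    have "norm (\<Sum>i<k. (1 / w (m + i)) *\<^sub>R (w (m + i) *\<^sub>R a (m + i))) \<le> 1 / w (m + 0) * e" if "m \<ge> M" for m k
      by (rule abel_inequality) (use M that inv in auto)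
    hence "norm (\<Sum>i<k. a (m + i)) \<le> e / w m" if "m \<ge> M" for m k
      using that by (simp add: nz)
    thus ?thesis by blast
  qed
  have w0: "w 0 \<le> w m" for m
    by (rule lift_Suc_mono_le[of w]) (auto intro: incr)
  show a: "summable a"
    unfolding summable_iff_small_segments
  proof safe
    fix e :: real assume e: "e > 0"
    with *[of "e * w 0"] pos[of 0] obtain M
      where M: "\<And>m k. m \<ge> M \<Longrightarrow> norm (\<Sum>i<k. a (m + i)) \<le> e * w 0 / w m" by auto
    have "e * w 0 / w m \<le> e" for m
      using e w0[of m] pos[of m] by (simp add: field_simps)
    with M show "\<exists>M. \<forall>m\<ge>M. \<forall>k. norm (\<Sum>i<k. a (m + i)) \<le> e" by (meson order.trans)
  qed
  show "(\<lambda>N. w N *\<^sub>R (\<Sum>n. a (n + N))) \<longlonglongrightarrow> 0"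
    unfolding lim_sequentially
  proof safe
    fix e :: real assume e: "e > 0"
    with *[of "e / 2"] obtain M where M: "\<And>m k. m \<ge> M \<Longrightarrow> norm (\<Sum>i<k. a (m + i)) \<le> e / 2 / w m" by auto
    have "dist (w N *\<^sub>R (\<Sum>n. a (n + N))) 0 < e" if "N \<ge> M" for N
    proof -
      have "(\<lambda>k. norm (\<Sum>i<k. a (i + N))) \<longlonglongrightarrow> norm (\<Sum>n. a (n + N))"
        using a by (intro tendsto_norm summable_LIMSEQ summable_ignore_initial_segment)
      hence "norm (\<Sum>n. a (n + N)) \<le> e / 2 / w N"
        by (rule LIMSEQ_le_const2) (use M[OF that] in \<open>auto simp: add.commute\<close>)
      hence "w N * norm (\<Sum>n. a (n + N)) \<le> e / 2"
        using pos[of N] by (simp add: field_simps)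
      thus ?thesis using e pos[of N] by simp
    qed
    thus "\<exists>no. \<forall>n\<ge>no. dist (w n *\<^sub>R (\<Sum>na. a (na + n))) 0 < e" by blast
  qed
qed

text \<open>Dirichlet's test with bounded variation in place of monotonicity, as the coefficients
  are complex. Multiplying the partial sums by \<open>1 - x\<close> leaves the differences of
  \<open>b\<close>, which are absolutely summable, and \<open>x \<noteq> 1\<close> permits dividing
  back.\<close>

lemma summable_bounded_variation_unit_circle:
  fixes b :: "nat \<Rightarrow> complex"
  assumes b: "b \<longlonglongrightarrow> 0" and var: "summable (\<lambda>n. norm (b (Suc n) - b n))"
    and x: "norm x = 1" "x \<noteq> 1"
  shows "summable (\<lambda>n. b n * x ^ n)"
proof -
  have "(1 - x) * (\<Sum>n<N. b n * x ^ n) = b 0 - b N * x ^ N + (\<Sum>n<N. (b (Suc n) - b n) * x ^ Suc n)" for N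
  proof (induction N)
    case (Suc N)
    show ?case
      unfolding sum.lessThan_Suc distrib_left Suc by (simp add: algebra_simps)
  qed auto
  hence eq: "(\<Sum>n<N. b n * x ^ n) = (b 0 - b N * x ^ N + (\<Sum>n<N. (b (Suc n) - b n) * x ^ Suc n)) / (1 - x)" for N
    using x by (simp add: eq_divide_eq mult.commute)
  have "summable (\<lambda>n. (b (Suc n) - b n) * x ^ Suc n)"
    by (rule summable_norm_cancel) (use var x in \<open>simp add: norm_mult norm_power\<close>)
  moreover have "(\<lambda>N. b N * x ^ N) \<longlonglongrightarrow> 0"
    using b x by (subst tendsto_norm_zero_iff [symmetric]) (simp add: norm_mult norm_power tendsto_norm_zero_iff)
  ultimately have "(\<lambda>N. \<Sum>n<N. b n * x ^ n) \<longlonglongrightarrow> (b 0 - 0 + (\<Sum>n. (b (Suc n) - b n) * x ^ Suc n)) / (1 - x)"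
    unfolding eq using x by (intro tendsto_intros summable_LIMSEQ) auto
  thus ?thesis unfolding summable_def sums_def by blast
qed

section \<open>Termwise integration of power series in the open unit disc\<close>

lemma DERIV_powser_Suc:
  fixes c :: "nat \<Rightarrow> 'a :: {real_normed_field, banach}"
  assumes summable: "\<And>z. norm z < 1 \<Longrightarrow> summable (\<lambda>n. c n * z ^ n)" and z: "norm z < 1"
  shows "((\<lambda>z. \<Sum>n. c n / of_nat (Suc n) * z ^ Suc n) has_field_derivative (\<Sum>n. c n * z ^ n)) (at z)"
    and "summable (\<lambda>n. c n / of_nat (Suc n) * z ^ Suc n)"
proof -
  \<comment> \<open>At \<open>n = 0\<close> this is \<open>c 0 / 0 = 0\<close>, so the
    antiderivative has no constant term and \<open>diffs c' = c\<close>.\<close>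
  define c' where "c' n = c (n - 1) / of_nat n" for n
  have sm: "summable (\<lambda>n. c' (Suc n) * z ^ Suc n)" if z: "norm z < 1" for z
  proof (rule summable_norm_cancel, rule summable_comparison_test')
    \<comment> \<open>A radius strictly between \<open>norm z\<close> and 1 upgrades convergence at
      \<open>r\<close> to absolute convergence at \<open>z\<close>.\<close>
    from z obtain r where r: "norm z < r" "r < 1" using dense by blast
    hence "r > 0" using norm_ge_zero[of z] by linarith
    have "summable (\<lambda>n. norm (c n * z ^ n))"
      by (rule powser_insidea[OF summable[of "of_real r"]]) (use r \<open>r > 0\<close> in auto)
    thus "summable (\<lambda>n. norm (c n * z ^ n) * norm z)" by (rule summable_mult2)
  next
    fix n :: nat
    have "norm (c n) / real (Suc n) \<le> norm (c n) / 1"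
      by (rule divide_left_mono) auto
    hence "norm (c' (Suc n)) \<le> norm (c n)"
      by (simp add: c'_def norm_divide del: of_nat_Suc)
    thus "norm (norm (c' (Suc n) * z ^ Suc n)) \<le> norm (c n * z ^ n) * norm z"
      using mult_right_mono[of "norm (c' (Suc n))" "norm (c n)" "norm z ^ Suc n"]
      by (simp add: norm_mult norm_power mult_ac)
  qed
  hence sm': "summable (\<lambda>n. c' n * z ^ n)" if "norm z < 1" for z
    using that by (subst (asm) summable_Suc_iff)
  show "summable (\<lambda>n. c n / of_nat (Suc n) * z ^ Suc n)"
    using sm[OF z] by (simp add: c'_def)
  have eq: "(\<Sum>n. c' n * z ^ n) = (\<Sum>n. c n / of_nat (Suc n) * z ^ Suc n)" if "norm z < 1" for z
    using suminf_split_head[OF sm'[OF that]] by (simp add: c'_def)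
  have "((\<lambda>z. \<Sum>n. c' n * z ^ n) has_field_derivative (\<Sum>n. diffs c' n * z ^ n)) (at z)"
    by (rule termdiffs_strong'[OF sm' z])
  also have "diffs c' = c"
    by (simp add: diffs_def c'_def fun_eq_iff del: of_nat_Suc)
  finally show "((\<lambda>z. \<Sum>n. c n / of_nat (Suc n) * z ^ Suc n) has_field_derivative (\<Sum>n. c n * z ^ n)) (at z)"
    by (rule has_field_derivative_transform_within_open[of _ _ _ "ball 0 1"]) (use z eq in auto)
qed

subsection \<open>Harmonic series on the unit circle\<close>

lemma norm_gen_harm_le_harm:
  assumes "r \<ge> 1"
  shows "norm (gen_harm r n :: 'a :: real_normed_field) \<le> harm n"
  unfolding gen_harm_def harm_def
proof (intro order.trans[OF norm_sum] sum_mono)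
  fix k assume "k \<in> {1..n}"
  hence "real k ^ 1 \<le> real k ^ r" using assms by (intro power_increasing) auto
  thus "norm (1 / of_nat k ^ r :: 'a) \<le> inverse (real k)"
    using \<open>k \<in> {1..n}\<close> by (auto simp: norm_divide norm_power field_simps)
qed

lemma norm_powr_of_nat_Suc: "norm (of_nat (Suc n) powr s :: complex) = real (Suc n) powr Re s"
  by (subst norm_powr_real_powr) auto

text \<open>The mean value inequality for \<open>z powr (-s)\<close> on the real segment between the
  two integers; the modulus of the derivative is largest at the left end.\<close>

lemma norm_diff_powr_minus_le:
  "norm (1 / of_nat (Suc (Suc n)) powr s - 1 / of_nat (Suc n) powr s :: complex) \<le>
     norm s / real (Suc n) powr (Re s + 1)" if "Re s > 0"
proof -
  define S where "S = complex_of_real ` {real (Suc n)..real (Suc (Suc n))}"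
  have "norm (complex_of_real (real (Suc (Suc n))) powr (-s) - complex_of_real (real (Suc n)) powr (-s)) \<le>
        norm s * real (Suc n) powr (- Re s - 1) * norm (complex_of_real (real (Suc (Suc n))) - complex_of_real (real (Suc n)))"
  proof (rule field_differentiable_bound)
    show "convex S" unfolding S_def by (intro convex_linear_image) (auto simp: linear_iff scaleR_conv_of_real)
    fix z assume "z \<in> S"
    then obtain t where t: "z = of_real t" "t \<ge> real (Suc n)" by (auto simp: S_def)
    hence "t > 0" by linarith
    show "((\<lambda>z. z powr (-s)) has_field_derivative (-s) * z powr (-s - 1)) (at z within S)"
      by (rule has_field_derivative_at_within)
         (use t \<open>t > 0\<close> in \<open>auto intro!: derivative_eq_intros simp: complex_nonpos_Reals_iff\<close>)
    have "t powr (- Re s - 1) \<le> real (Suc n) powr (- Re s - 1)"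
      using t that by (intro powr_mono2') auto
    thus "norm (-s * z powr (-s - 1)) \<le> norm s * real (Suc n) powr (- Re s - 1)"
      using t \<open>t > 0\<close> by (auto simp: norm_mult norm_powr_real_powr intro!: mult_left_mono)
  qed (unfold S_def, (intro imageI; simp)+)
  also have "\<dots> = norm s / real (Suc n) powr (Re s + 1)"
    by (simp add: powr_minus[of _ "Re s + 1", simplified] divide_inverse)
  finally show ?thesis by (simp add: powr_minus divide_inverse)
qed

text \<open>The coefficients tend to 0 since \<open>ln n\<close> is dominated by
  \<open>n powr Re s\<close>. Their increments split into a harmonic number times an increment of
  the power, and one new harmonic term; both are of order \<open>harm n / n powr (Re s + 1)\<close>,
  which is summable.\<close>

lemma summable_gen_harm_unit_circle:
  fixes x s :: complex
  assumes r: "r \<ge> 1" and s: "Re s > 0" and x: "norm x = 1" "x \<noteq> 1"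
  shows "summable (\<lambda>n. gen_harm r (Suc n) / of_nat (Suc n) powr s * x ^ Suc n)"
proof -
  define b :: "nat \<Rightarrow> complex" where "b n = gen_harm r (Suc n) / of_nat (Suc n) powr s" for n
  have norm_b: "norm (b n) \<le> harm (Suc n) / real (Suc n) powr Re s" for n
    unfolding b_def norm_divide norm_powr_of_nat_Suc
    by (intro divide_right_mono norm_gen_harm_le_harm r) auto
  have "(\<lambda>n. harm n / real n powr Re s) \<in> O(\<lambda>n. ln (real n) / real n powr Re s)"
    by (intro landau_o.big.divide_right harm_bigo) (auto intro: eventually_sequentiallyI[of 1])
  also have "(\<lambda>n. ln (real n) / real n powr Re s) \<in> o(\<lambda>_. 1)" using s by real_asymp
  finally have "(\<lambda>n. harm n / real n powr Re s) \<longlonglongrightarrow> 0"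
    by (auto dest: smalloD_tendsto)
  hence "(\<lambda>n. harm (Suc n) / real (Suc n) powr Re s) \<longlonglongrightarrow> 0"
    by (rule LIMSEQ_Suc)
  hence "b \<longlonglongrightarrow> 0"
    by (rule Lim_null_comparison[rotated]) (use norm_b in auto)
  moreover have "summable (\<lambda>n. norm (b (Suc n) - b n))"
  proof (rule summable_comparison_test')
    show "summable (\<lambda>n. harm (Suc n) / real (Suc n) powr (Re s + 1) * norm s +
             harm (Suc n) / real (Suc n) powr (Re s + 1))"
      using s by (intro summable_add summable_mult2 summable_harm_powr) auto
    fix n :: nat
    have "b (Suc n) - b n = gen_harm r (Suc n) * (1 / of_nat (Suc (Suc n)) powr s - 1 / of_nat (Suc n) powr s)
            + 1 / of_nat (Suc (Suc n)) ^ r * (1 / of_nat (Suc (Suc n)) powr s)"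
      by (simp add: b_def gen_harm_Suc[of _ "Suc n"] algebra_simps add_divide_distrib del: of_nat_Suc)
    also have "norm \<dots> \<le> harm (Suc n) * (norm s / real (Suc n) powr (Re s + 1)) + 1 / real (Suc n) powr (Re s + 1)"
    proof (intro norm_triangle_mono)
      show "norm (gen_harm r (Suc n) * (1 / of_nat (Suc (Suc n)) powr s - 1 / of_nat (Suc n) powr s :: complex))
            \<le> harm (Suc n) * (norm s / real (Suc n) powr (Re s + 1))"
        unfolding norm_mult by (intro mult_mono norm_gen_harm_le_harm norm_diff_powr_minus_le r s harm_nonneg) auto
      have "real (Suc n) powr (Re s + 1) \<le> real (Suc (Suc n)) powr (Re s + 1)"
        using s by (intro powr_mono2) auto
      also have "\<dots> = real (Suc (Suc n)) ^ 1 * real (Suc (Suc n)) powr (Re s)"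
        by (simp add: powr_add)
      also have "\<dots> \<le> real (Suc (Suc n)) ^ r * real (Suc (Suc n)) powr (Re s)"
        using r by (intro mult_right_mono power_increasing) auto
      finally have "1 / (real (Suc (Suc n)) ^ r * real (Suc (Suc n)) powr (Re s)) \<le> 1 / real (Suc n) powr (Re s + 1)"
        by (intro divide_left_mono) auto
      thus "norm (1 / of_nat (Suc (Suc n)) ^ r * (1 / of_nat (Suc (Suc n)) powr s) :: complex)
             \<le> 1 / real (Suc n) powr (Re s + 1)"
        by (simp add: norm_mult norm_divide norm_power norm_powr_of_nat_Suc del: of_nat_Suc)
    qed
    also have "1 / real (Suc n) powr (Re s + 1) \<le> harm (Suc n) / real (Suc n) powr (Re s + 1)"
      using harm_mono[of 1 "Suc n", where 'a = real] by (intro divide_right_mono) (auto simp: harm_expand)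
    finally show "norm (norm (b (Suc n) - b n)) \<le> harm (Suc n) / real (Suc n) powr (Re s + 1) * norm s +
             harm (Suc n) / real (Suc n) powr (Re s + 1)" by (simp add: mult_ac)
  qed
  ultimately have "summable (\<lambda>n. b n * x ^ n)"
    using x by (rule summable_bounded_variation_unit_circle)
  from summable_mult2[OF this, of x] show ?thesis by (simp add: b_def mult_ac)
qed

subsection \<open>The integral representation\<close>

text \<open>
  Summation by parts turns the integrand into the power series whose coefficients are the tails
  \<open>R k\<close> of the series of \<open>a\<close>. Its antiderivative is continuous up to \<open>1\<close> by Abel's theorem, so
  the fundamental theorem of calculus applies although the integrand may be unbounded there.
\<close>

lemma harm_weighted_series_has_integral:
  fixes a :: "nat \<Rightarrow> complex"
  assumes summable: "summable (\<lambda>n. harm (Suc n) * a n)"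
  shows "((\<lambda>u. ((\<Sum>n. a n) - (\<Sum>n. a n * of_real u ^ Suc n)) / (1 - of_real u)) has_integral
           (\<Sum>n. harm (Suc n) * a n)) {0..1}"
proof -
  define R where "R k = (\<Sum>n. a (n + k))" for k
  have *: "summable (\<lambda>n. (harm (Suc n) :: real) *\<^sub>R a n)"
    using summable by (simp add: scaleR_conv_of_real of_real_harm)
  have harm: "(0::real) < harm (Suc n)" "(harm (Suc n) :: real) \<le> harm (Suc (Suc n))" for n
    by (auto intro: harm_mono)
  note a = summable_weighted_tail[OF * harm]
  have R_Suc: "R (Suc k) = R k - a k" for k
    using suminf_split_head[OF summable_ignore_initial_segment[OF a(1), of k]] by (simp add: R_def)
  \<comment> \<open>The tail lemma requires positive weights, whereas \<open>harm 0 = 0\<close>; the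
    boundary term with \<open>harm N\<close> is therefore dominated by the one with
    \<open>harm (Suc N)\<close>.\<close>
  have "(\<lambda>N. norm ((harm (Suc N) :: real) *\<^sub>R R N)) \<longlonglongrightarrow> 0"
    using tendsto_norm[OF a(2)] by (simp add: R_def)
  moreover have "norm (harm N * R N) \<le> norm ((harm (Suc N) :: real) *\<^sub>R R N)" for N
    using harm_mono[of N "Suc N", where 'a = real] 
    by (auto simp: norm_mult norm_harm intro!: mult_right_mono)
  ultimately have lim: "(\<lambda>N. harm N * R N) \<longlonglongrightarrow> 0"
    by (intro Lim_null_comparison[of "\<lambda>N. harm N * R N" "\<lambda>N. norm ((harm (Suc N) :: real) *\<^sub>R R N)"]) auto
  have partial: "(\<Sum>k<N. R k / of_nat (Suc k)) = (\<Sum>n<N. harm (Suc n) * a n) + harm N * R N" for N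
    by (induction N) (auto simp: harm_Suc R_Suc harm_expand algebra_simps divide_inverse)
  have sums: "(\<lambda>k. R k / of_nat (Suc k)) sums (\<Sum>n. harm (Suc n) * a n)"
    unfolding sums_def partial using tendsto_add[OF summable_LIMSEQ[OF summable] lim] by simp

  have "R \<longlonglongrightarrow> 0"
    unfolding R_def using a(1) by (rule suminf_exist_split2)
  hence "Bseq R" by (intro convergent_imp_Bseq) (auto simp: convergent_def)
  then obtain K where K: "\<And>k. norm (R k) \<le> K" by (auto simp: Bseq_def)
  have sm: "summable (\<lambda>k. R k * z ^ k)" if "norm z < 1" for z
  proof (rule summable_comparison_test')
    show "summable (\<lambda>k. K * norm z ^ k)" using that by (intro summable_mult summable_geometric) auto
  qed (auto simp: norm_mult norm_power intro!: mult_right_mono K)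

  define F where "F u = (\<Sum>k. R k / of_nat (Suc k) * of_real u ^ Suc k)" for u :: real
  have "((\<lambda>u. ((\<Sum>n. a n) - (\<Sum>n. a n * of_real u ^ Suc n)) / (1 - of_real u)) has_integral (F 1 - F 0)) {0..1}"
  proof (rule fundamental_theorem_of_calculus_interior)
    have "continuous_on {0..1} (\<lambda>u :: real. of_real u * (\<Sum>k. u ^ k *\<^sub>R (R k / of_nat (Suc k))))"
      by (intro continuous_intros abel_continuous_on sums_summable[OF sums])
    also have "?this \<longleftrightarrow> continuous_on {0..1} F"
    proof (rule continuous_on_cong)
      fix u :: real assume "u \<in> {0..1}"
      from suminf_mult[OF abel_summable[OF sums_summable[OF sums] this], of "of_real u"]
      show "of_real u * (\<Sum>k. u ^ k *\<^sub>R (R k / of_nat (Suc k))) = F u"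
        by (simp add: F_def scaleR_conv_of_real mult_ac)
    qed auto
    finally show "continuous_on {0..1} F" .
  next
    fix u :: real assume u: "u \<in> {0<..<1}"
    define z where "z = complex_of_real u"
    have z: "norm z < 1" "z \<noteq> 1" using u by (auto simp: z_def)
    have az: "summable (\<lambda>n. a n * z ^ Suc n)"
      using summable_mult[OF abel_summable[OF a(1), of u], of z] u
      by (simp add: z_def scaleR_conv_of_real mult_ac)
    \<comment> \<open>With g(z) the power series of the tails, the recursion R_(k+1) = R_k - a_k
      becomes (1 - z) g(z) = R_0 - (the series of a_k z^(k+1)).\<close>
    have "(\<Sum>k. R k * z ^ k) = R 0 + (\<Sum>k. R (Suc k) * z ^ Suc k)"
      using suminf_split_head[OF sm[OF z(1)]] by simp
    also have "(\<Sum>k. R (Suc k) * z ^ Suc k) = (\<Sum>k. R k * z ^ k * z - a k * z ^ Suc k)"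
      by (simp add: R_Suc algebra_simps)
    also have "\<dots> = (\<Sum>k. R k * z ^ k) * z - (\<Sum>k. a k * z ^ Suc k)"
      by (subst suminf_diff [OF summable_mult2[OF sm[OF z(1)]] az, symmetric])
         (simp add: suminf_mult2[OF sm[OF z(1)]])
    finally have "(\<Sum>k. R k * z ^ k) = ((\<Sum>n. a n) - (\<Sum>n. a n * z ^ Suc n)) / (1 - z)"
      using z by (simp add: R_def field_simps)
    moreover have "((\<lambda>z. \<Sum>k. R k / of_nat (Suc k) * z ^ Suc k) has_field_derivative (\<Sum>k. R k * z ^ k)) (at z)"
      by (rule DERIV_powser_Suc[OF sm z(1)])
    ultimately show "(F has_vector_derivative
        ((\<Sum>n. a n) - (\<Sum>n. a n * of_real u ^ Suc n)) / (1 - of_real u)) (at u)"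
      unfolding F_def z_def using has_vector_derivative_real_field by fastforce
  qed auto
  moreover have "F 1 = (\<Sum>n. harm (Suc n) * a n)"
    using sums by (simp add: F_def sums_iff)
  moreover have "F 0 = 0" by (simp add: F_def)
  ultimately show ?thesis by simp
qed

text \<open>On the segment, dy contributes a factor \<open>x\<close> that cancels the one in
  \<open>x - y = x (1 - u)\<close>. Convergence of the harmonic series is the sole hypothesis, so
  interior and boundary points are treated alike.\<close>

lemma polylog_integral:
  fixes s x :: complex
  assumes "summable (\<lambda>n. gen_harm 1 (Suc n) / of_nat (Suc n) powr s * x ^ Suc n)"
  shows "((\<lambda>y. (polylog s x - polylog s y) / (x - y)) has_contour_integral
           (\<Sum>n. gen_harm 1 (Suc n) / of_nat (Suc n) powr s * x ^ Suc n)) (linepath 0 x)"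
proof (cases "x = 0")
  case False
  define a where "a n = x ^ Suc n / of_nat (Suc n) powr s" for n
  have eq: "gen_harm 1 (Suc n) / of_nat (Suc n) powr s * x ^ Suc n = harm (Suc n) * a n" for n
    by (simp add: a_def gen_harm_1_eq_harm del: of_nat_Suc)
  have "((\<lambda>u. ((\<Sum>n. a n) - (\<Sum>n. a n * of_real u ^ Suc n)) / (1 - of_real u)) has_integral
           (\<Sum>n. harm (Suc n) * a n)) {0..1}"
    by (rule harm_weighted_series_has_integral) (use assms in \<open>simp only: eq\<close>)
  also have "(\<lambda>u. ((\<Sum>n. a n) - (\<Sum>n. a n * of_real u ^ Suc n)) / (1 - of_real u)) =
             (\<lambda>u. (polylog s x - polylog s (linepath 0 x u)) / (x - linepath 0 x u) * (x - 0))"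
  proof
    fix u :: real
    have "polylog s (linepath 0 x u) = (\<Sum>n. a n * of_real u ^ Suc n)"
      by (simp add: a_def polylog_def linepath_def scaleR_conv_of_real power_mult_distrib mult_ac del: of_nat_Suc power_Suc)
    moreover have "polylog s x = (\<Sum>n. a n)"
      by (simp add: a_def polylog_def)
    moreover have "x - linepath 0 x u = x * (1 - of_real u)"
      by (simp add: linepath_def scaleR_conv_of_real algebra_simps)
    ultimately show "((\<Sum>n. a n) - (\<Sum>n. a n * of_real u ^ Suc n)) / (1 - of_real u) =
        (polylog s x - polylog s (linepath 0 x u)) / (x - linepath 0 x u) * (x - 0)"
      using False by simp
  qed
  finally show ?thesis unfolding eq by (simp add: has_contour_integral_linepath)
qed auto

lemma summable_harm_polylog:
  fixes s x :: complex
  assumes "norm x < 1 \<or> (norm x = 1 \<and> (Re s > 1 \<or> (x \<noteq> 1 \<and> Re s > 0)))"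
  shows "summable (\<lambda>n. gen_harm 1 (Suc n) / of_nat (Suc n) powr s * x ^ Suc n)"
proof -
  have norm_eq: "norm (gen_harm 1 (Suc n) / of_nat (Suc n) powr s * x ^ Suc n) =
        harm (Suc n) / real (Suc n) powr Re s * norm x ^ Suc n" for n
    by (simp add: norm_mult norm_divide norm_power norm_powr_of_nat_Suc gen_harm_1_eq_harm norm_harm
             del: of_nat_Suc)
  consider "norm x < 1" | "norm x = 1" "Re s > 1" | "norm x = 1" "x \<noteq> 1" "Re s > 0"
    using assms by blast
  thus ?thesis
  proof cases
    case 1
    \<comment> \<open>The midpoint of \<open>norm x\<close> and 1 is positive even for
      \<open>x = 0\<close>, and its geometric decay beats \<open>n powr (- Re s)\<close> for every
      \<open>s\<close>.\<close>
    define r where "r = (norm x + 1) / 2"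
    have r: "0 < r" "r < 1" "norm x \<le> r" using 1 norm_ge_zero[of x] by (auto simp: r_def add_nonneg_pos)
    have "(\<lambda>n. harm n / real n powr Re s * r ^ n) \<in> O(\<lambda>n. ln (real n) / real n powr Re s * r ^ n)"
      by (intro landau_o.big.divide_right landau_o.big.mult harm_bigo)
         (auto intro: eventually_sequentiallyI[of 1])
    also have "(\<lambda>n. ln (real n) / real n powr Re s * r ^ n) \<in> O(\<lambda>n. real n powr (-2))"
      using r by real_asymp
    finally have "summable (\<lambda>n. harm n / real n powr Re s * r ^ n)"
      by (rule_tac summable_comparison_test_bigo) (auto simp: summable_real_powr_iff)
    hence sm: "summable (\<lambda>n. harm (Suc n) / real (Suc n) powr Re s * r ^ Suc n)"
      by (subst summable_Suc_iff)
    show ?thesis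
    proof (rule summable_comparison_test'[OF sm])
      fix n
      show "norm (gen_harm 1 (Suc n) / of_nat (Suc n) powr s * x ^ Suc n) \<le>
              harm (Suc n) / real (Suc n) powr Re s * r ^ Suc n"
        unfolding norm_eq using r
        by (intro mult_left_mono power_mono divide_nonneg_nonneg harm_nonneg) auto
    qed
  next
    case 2
    show ?thesis
      by (rule summable_norm_cancel, unfold norm_eq) (use summable_harm_powr[OF 2(2)] 2 in simp)
  qed (use summable_gen_harm_unit_circle[of 1] in auto)
qed

subsection \<open>Polylogarithms of integer order\<close>

text \<open>At integer order \<open>powr\<close> becomes an ordinary power, so one differentiation
  theory covers both real and complex arguments; zeta values are \<open>Li k 1\<close>.\<close>

definition Li :: "nat \<Rightarrow> 'a \<Rightarrow> 'a :: {real_normed_field, banach}" where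
  "Li k x = (\<Sum>n. x ^ Suc n / of_nat (Suc n) ^ k)"

lemma polylog_eq_Li_complex: "polylog (of_nat k) (x :: complex) = Li k x"
  by (simp add: polylog_def Li_def powr_nat' del: of_nat_Suc)

lemma polylog_eq_Li_real: "polylog (of_nat k) (x :: real) = Li k x"
  by (simp add: polylog_def Li_def powr_realpow del: of_nat_Suc)

lemma zeta_eq_Li_complex: "zeta (of_nat k) = Li k (1 :: complex)"
  by (simp add: zeta_def Li_def powr_nat' del: of_nat_Suc)

lemma zeta_eq_Li_real: "zeta (of_nat k) = Li k (1 :: real)"
  by (simp add: zeta_def Li_def powr_realpow del: of_nat_Suc)

lemma Li_0 [simp]: "Li k 0 = 0"
  by (simp add: Li_def)

lemma norm_Li_term_le:
  assumes "norm z \<le> r"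
  shows "norm (z ^ Suc n / of_nat (Suc n) ^ k :: 'a :: {real_normed_field, banach}) \<le> r ^ Suc n / real (Suc n) ^ k"
  unfolding norm_divide norm_power norm_of_nat using assms
  by (intro divide_right_mono power_mono) auto

lemma summable_Li_disc:
  assumes "norm (z :: 'a :: {real_normed_field, banach}) < 1"
  shows "summable (\<lambda>n. norm (z ^ n / of_nat (Suc n) ^ k))"
proof (rule summable_comparison_test')
  show "summable (\<lambda>n. norm z ^ n)" using assms by (intro summable_geometric) auto
  fix n :: nat
  have "norm z ^ n / real (Suc n) ^ k \<le> norm z ^ n / 1"
    by (intro divide_left_mono) auto
  thus "norm (norm (z ^ n / of_nat (Suc n) ^ k)) \<le> norm z ^ n"
    by (simp add: norm_divide norm_power del: of_nat_Suc)
qed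

lemma summable_Li:
  assumes "norm (z :: 'a :: {real_normed_field, banach}) < 1 \<or> norm z \<le> 1 \<and> k \<ge> 2"
  shows "summable (\<lambda>n. z ^ Suc n / of_nat (Suc n) ^ k)"
  using assms
proof
  assume "norm z < 1"
  from summable_mult[OF summable_norm_cancel[OF summable_Li_disc[OF this]], of z] show ?thesis by simp
next
  assume *: "norm z \<le> 1 \<and> k \<ge> 2"
  show ?thesis
  proof (rule summable_norm_cancel, rule summable_comparison_test')
    show "summable (\<lambda>n. 1 / real (Suc n) ^ k)" using * sums_zeta[of k] by (simp add: sums_iff)
    show "norm (norm (z ^ Suc n / of_nat (Suc n) ^ k)) \<le> 1 / real (Suc n) ^ k" for n
      using norm_Li_term_le[of z 1 n k] * by simp
  qed
qed

lemma Li_of_real: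
  assumes "\<bar>x\<bar> < 1 \<or> \<bar>x\<bar> \<le> 1 \<and> k \<ge> 2"
  shows "Li k (of_real x) = (of_real (Li k x) :: 'a :: {real_normed_field, banach})"
  using suminf_of_real[OF summable_Li[of x k], where ?'a = 'a] assms
  by (simp add: Li_def del: of_nat_Suc)

lemma continuous_on_Li_disc:
  assumes "k \<ge> 2"
  shows "continuous_on (cball 0 1) (Li k :: 'a \<Rightarrow> 'a :: {real_normed_field, banach})"
proof (rule uniform_limit_theorem)
  show "uniform_limit (cball 0 1) (\<lambda>N z. \<Sum>n<N. z ^ Suc n / of_nat (Suc n) ^ k) (Li k :: 'a \<Rightarrow> 'a) sequentially"
    unfolding Li_def
  proof (rule Weierstrass_m_test)
    show "summable (\<lambda>n. 1 / real (Suc n) ^ k)" using assms sums_zeta[of k] by (simp add: sums_iff)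
    show "norm (z ^ Suc n / of_nat (Suc n) ^ k) \<le> 1 / real (Suc n) ^ k" if "z \<in> cball 0 1" for n and z :: 'a
      using norm_Li_term_le[of z 1 n k] that by simp
  qed
qed (auto intro!: always_eventually continuous_intros simp del: of_nat_Suc)

lemma continuous_on_Li [continuous_intros]:
  assumes "continuous_on S f" "k \<ge> 2" "\<And>x. x \<in> S \<Longrightarrow> norm (f x) \<le> 1"
  shows "continuous_on S (\<lambda>x. Li k (f x))"
  by (rule continuous_on_compose2[OF continuous_on_Li_disc assms(1)]) (use assms in auto)

lemma DERIV_Li:
  fixes z :: "'a :: {real_normed_field, banach}"
  assumes "norm z < 1" "z \<noteq> 0"
  shows "(Li (Suc k) has_field_derivative Li k z / z) (at z)"
proof -
  have sm: "summable (\<lambda>n. 1 / of_nat (Suc n) ^ k * z ^ n)" if "norm z < 1" for z :: 'a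
    using summable_norm_cancel[OF summable_Li_disc[OF that]] by simp
  have "Li (Suc k) = (\<lambda>z :: 'a. \<Sum>n. 1 / of_nat (Suc n) ^ k / of_nat (Suc n) * z ^ Suc n)"
    by (rule ext) (simp add: Li_def mult_ac del: of_nat_Suc)
  moreover have "Li k z / z = (\<Sum>n. 1 / of_nat (Suc n) ^ k * z ^ n)"
    using suminf_mult[OF sm[OF assms(1)], of z] assms(2) by (simp add: Li_def mult_ac del: of_nat_Suc)
  ultimately show ?thesis using DERIV_powser_Suc(1)[OF sm assms(1)] by simp
qed

lemma DERIV_Li_numeral:
  fixes z :: "'a :: {real_normed_field, banach}"
  assumes "norm z < 1" "z \<noteq> 0"
  shows "(Li 2 has_field_derivative Li 1 z / z) (at z)"
    and "(Li 3 has_field_derivative Li 2 z / z) (at z)"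
    and "(Li 4 has_field_derivative Li 3 z / z) (at z)"
  using DERIV_Li[OF assms, of 1] DERIV_Li[OF assms, of 2] DERIV_Li[OF assms, of 3]
  by (simp_all add: eval_nat_numeral)

lemmas DERIV_Li_numeral' [derivative_intros] = DERIV_Li_numeral[THEN DERIV_chain2]

lemma Li_1_complex:
  assumes "norm (z :: complex) < 1" shows "Li 1 z = - ln (1 - z)"
proof -
  have "(\<lambda>n. z ^ n / of_nat n) sums - ln (1 - z)"
    using sums_minus[OF Ln_series'[of "-z"]] assms by simp
  hence "(\<lambda>n. z ^ Suc n / of_nat (Suc n)) sums - ln (1 - z)"
    by (subst sums_Suc_iff) simp
  thus ?thesis by (simp add: Li_def sums_iff)
qed

lemma Li_1_real:
  assumes "\<bar>x :: real\<bar> < 1" shows "Li 1 x = - ln (1 - x)"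
proof -
  have "complex_of_real (Li 1 x) = of_real (- ln (1 - x))"
    using Li_1_complex[of "of_real x"] assms Li_of_real[of x 1, where ?'a = complex] Ln_of_real[of "1 - x"] by simp
  thus ?thesis by (simp only: of_real_eq_iff)
qed

text \<open>
  The generating function of the generalized harmonic numbers is the Cauchy product of
  \<open>Li r z / z\<close> and the geometric series.
\<close>

lemma gen_harm_sums:
  fixes z :: "'a :: {real_normed_field, banach}"
  assumes "norm z < 1"
  shows "(\<lambda>n. gen_harm r (Suc n) * z ^ n) sums ((\<Sum>n. z ^ n / of_nat (Suc n) ^ r) / (1 - z))"
proof -
  have "(\<lambda>n. \<Sum>i\<le>n. z ^ i / of_nat (Suc i) ^ r * z ^ (n - i)) sums ((\<Sum>n. z ^ n / of_nat (Suc n) ^ r) * (\<Sum>n. z ^ n))"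
    by (rule Cauchy_product_sums[OF summable_Li_disc[OF assms]])
       (use assms in \<open>simp add: norm_power summable_geometric\<close>)
  also have "(\<lambda>n. \<Sum>i\<le>n. z ^ i / of_nat (Suc i) ^ r * z ^ (n - i)) = (\<lambda>n. gen_harm r (Suc n) * z ^ n)"
  proof
    fix n
    have "z ^ i / of_nat (Suc i) ^ r * z ^ (n - i) = 1 / of_nat (Suc i) ^ r * z ^ n" if "i \<le> n" for i
      using that by (simp add: power_add [symmetric])
    thus "(\<Sum>i\<le>n. z ^ i / of_nat (Suc i) ^ r * z ^ (n - i)) = gen_harm r (Suc n) * z ^ n"
      by (simp add: gen_harm_Suc_atMost [symmetric] sum_distrib_right del: of_nat_Suc)
  qed
  finally show ?thesis using assms by (simp add: suminf_geometric)
qed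

lemma gen_harm_series:
  fixes z :: "'a :: {real_normed_field, banach}"
  assumes "norm z < 1"
  shows "summable (\<lambda>n. gen_harm r (Suc n) / of_nat (Suc n) * z ^ Suc n)"
    and "z \<noteq> 0 \<Longrightarrow> ((\<lambda>z. \<Sum>n. gen_harm r (Suc n) / of_nat (Suc n) * z ^ Suc n)
            has_field_derivative Li r z / (z * (1 - z))) (at z)"
proof -
  note sm = sums_summable[OF gen_harm_sums]
  show "summable (\<lambda>n. gen_harm r (Suc n) / of_nat (Suc n) * z ^ Suc n)"
    by (rule DERIV_powser_Suc(2)[OF sm assms])
  assume "z \<noteq> 0"
  have "Li r z = z * (\<Sum>n. z ^ n / of_nat (Suc n) ^ r)"
    unfolding Li_def using summable_norm_cancel[OF summable_Li_disc[OF assms]]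
    by (subst suminf_mult [symmetric]) auto
  hence "Li r z / (z * (1 - z)) = (\<Sum>n. gen_harm r (Suc n) * z ^ n)"
    using sums_unique[OF gen_harm_sums[OF assms, of r]] \<open>z \<noteq> 0\<close> by simp
  with DERIV_powser_Suc(1)[OF sm assms, of r]
  show "((\<lambda>z. \<Sum>n. gen_harm r (Suc n) / of_nat (Suc n) * z ^ Suc n)
            has_field_derivative Li r z / (z * (1 - z))) (at z)" by simp
qed

text \<open>The condition |1 - x| \<le> 1 means |x|^2 \<le> 2 Re x, whence |1 - t x|^2 \<le> 1 - t
  (1 - t) |x|^2. Strictness comes from this quadratic term, although 0 and possibly \<open>x\<close>
  lie on the boundary.\<close>

lemma lens_ray:
  assumes "norm (x :: complex) \<le> 1" "norm (1 - x) \<le> 1" "x \<noteq> 0" "t \<in> {0<..<1}"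
  shows "norm (of_real t * x) < 1" "norm (1 - of_real t * x) < 1" "of_real t * x \<noteq> 0" "1 - of_real t * x \<noteq> 0"
proof -
  have *: "t * norm x < 1 * 1"
    using assms by (intro mult_less_le_imp_less) auto
  thus "norm (of_real t * x) < 1" using assms by (simp add: norm_mult)
  with norm_ge_zero show "1 - of_real t * x \<noteq> 0" by auto
  show "of_real t * x \<noteq> 0" using assms by auto
  have "(norm (1 - of_real t * x))\<^sup>2 = 1 - 2 * t * Re x + t\<^sup>2 * (norm x)\<^sup>2"
    unfolding cmod_power2 by (simp add: power2_eq_square algebra_simps)
  moreover have "(norm (1 - x))\<^sup>2 = 1 - 2 * Re x + (norm x)\<^sup>2"
    unfolding cmod_power2 by (simp add: power2_eq_square algebra_simps)
  moreover have "(norm (1 - x))\<^sup>2 \<le> 1" using assms by (simp add: power_le_one)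
  ultimately have "(norm (1 - of_real t * x))\<^sup>2 \<le> 1 - t * (norm x)\<^sup>2 + t\<^sup>2 * (norm x)\<^sup>2"
    using assms mult_left_mono[of "(norm x)\<^sup>2" "2 * Re x" t] by simp
  also have "\<dots> = 1 - t * (1 - t) * (norm x)\<^sup>2" by (simp add: power2_eq_square algebra_simps)
  also have "\<dots> < 1" using assms by simp
  finally show "norm (1 - of_real t * x) < 1"
    by (simp add: power_less_one_iff abs_square_less_1)
qed

text \<open>The derivative is required only inside the lens; both ends of the segment, which may lie
  on its boundary, form the exceptional set and enter through continuity.\<close>

lemma constant_on_ray:
  fixes f :: "complex \<Rightarrow> complex"
  assumes x: "norm x \<le> 1" "norm (1 - x) \<le> 1" "x \<noteq> 0"
    and cont: "continuous_on {0..1} (\<lambda>t. f (of_real t * x))"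
    and deriv: "\<And>z. norm z < 1 \<Longrightarrow> norm (1 - z) < 1 \<Longrightarrow> z \<noteq> 0 \<Longrightarrow> z \<noteq> 1 \<Longrightarrow> (f has_field_derivative 0) (at z)"
  shows "f x = f 0"
proof -
  have "f (of_real 1 * x) = f 0"
  proof (rule has_derivative_zero_unique_strong_convex[of "{0..1}" "{0, 1}" "\<lambda>t. f (of_real t * x)" 0])
    fix t :: real assume t: "t \<in> {0..1} - {0, 1}"
    hence "(f has_field_derivative 0) (at (of_real t * x))"
      using lens_ray[OF x, of t] by (intro deriv) auto
    moreover have "((\<lambda>t. of_real t * x) has_vector_derivative x) (at t)"
      by (auto intro!: derivative_eq_intros simp: scaleR_conv_of_real has_vector_derivative_def)
    ultimately have "((\<lambda>t. f (of_real t * x)) has_vector_derivative (x * 0)) (at t)"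
      using field_vector_diff_chain_at[of "\<lambda>t. of_real t * x" x t f 0] by (simp add: o_def)
    thus "((\<lambda>t. f (of_real t * x)) has_derivative (\<lambda>h. 0)) (at t within {0..1})"
      by (auto simp: has_vector_derivative_def intro: has_derivative_at_withinI)
  qed (use cont in auto)
  thus ?thesis by simp
qed

subsection \<open>Reflection and Landen identities\<close>

text \<open>Along the ray \<open>ln (t x) = ln t + ln x\<close>, while \<open>ln (1 - t x)\<close>
  is of order \<open>t\<close>; so the singularity is beaten by t ln t \<rightarrow> 0.\<close>

lemma ln_ln_tendsto_0:
  fixes x :: complex
  assumes "x \<noteq> 0"
  shows "((\<lambda>t. ln (of_real t * x) * ln (1 - of_real t * x)) \<longlongrightarrow> 0) (at_right 0)"
proof -
  have "((\<lambda>z :: complex. ln (1 - z)) has_field_derivative -1) (at 0)"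
    by (auto intro!: derivative_eq_intros)
  hence "((\<lambda>z :: complex. ln (1 - z) / z) \<longlongrightarrow> -1) (at 0)"
    by (simp add: DERIV_def)
  moreover have "filterlim (\<lambda>t. of_real t * x) (at 0) (at_right 0)"
  proof -
    have "((\<lambda>t. of_real t * x) \<longlongrightarrow> of_real 0 * x) (at_right 0)"
      by (intro tendsto_intros)
    thus ?thesis using assms by (auto simp: filterlim_at eventually_at_filter)
  qed
  ultimately have lim1: "((\<lambda>t. ln (1 - of_real t * x) / (of_real t * x)) \<longlongrightarrow> -1) (at_right 0)"
    by (rule filterlim_compose)
  have "((\<lambda>t :: real. t * ln t) \<longlongrightarrow> 0) (at_right 0)" by real_asymp
  from tendsto_of_real[OF this, where 'a = complex]
  have "((\<lambda>t. (of_real (t * ln t) + of_real t * ln x) * x) \<longlongrightarrow> (0 + of_real 0 * ln x) * x) (at_right 0)"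
    by (intro tendsto_intros) auto
  from tendsto_mult[OF this lim1]
  have "((\<lambda>t. (of_real (t * ln t) + of_real t * ln x) * x * (ln (1 - of_real t * x) / (of_real t * x))) \<longlongrightarrow> 0) (at_right 0)"
    by simp
  thus ?thesis
  proof (rule Lim_transform_eventually)
    show "\<forall>\<^sub>F t in at_right 0. (of_real (t * ln t) + of_real t * ln x) * x * (ln (1 - of_real t * x) / (of_real t * x)) =
            ln (of_real t * x) * ln (1 - of_real t * x)"
      using eventually_at_right_less[of 0]
    proof eventually_elim
      case (elim t)
      hence "ln (of_real t * x) = of_real (ln t) + ln x"
        using assms by (simp add: Ln_times_of_real Ln_of_real)
      thus ?case using elim assms by (simp add: field_simps)
    qed
  qed
qed

text \<open>The closed unit disc meets the line Re z = 1 only at 1. Applied to \<open>z\<close> and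
  to \<open>1 - z\<close>, this keeps logarithms in the lens off the branch cut.\<close>

lemma Re_less_1: "norm z \<le> 1 \<Longrightarrow> z \<noteq> 1 \<Longrightarrow> Re z < 1"
  using complex_Re_le_cmod[of z] cmod_power2[of z] 
  by (cases "Re z = 1") (auto simp: complex_eq_iff abs_square_le_1 power2_eq_square)

lemma dilog_reflection_complex:
  fixes x :: complex
  assumes x: "norm x \<le> 1" "norm (1 - x) \<le> 1" "x \<noteq> 0" "x \<noteq> 1"
  shows "Li 2 x + Li 2 (1 - x) + ln x * ln (1 - x) = Li 2 1"
proof -
  define f where "f z = Li 2 z + Li 2 (1 - z) + ln z * ln (1 - z)" for z :: complex
  have tx: "norm (of_real t * x) \<le> 1" "norm (1 - of_real t * x) \<le> 1" if "t \<in> {0..1}" for t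
    using lens_ray(1,2)[OF x(1-3), of t] x that by (cases "t \<in> {0, 1}"; force)+
  have Re: "Re z > 0" if "norm (1 - z) \<le> 1" "z \<noteq> 0" for z
    using Re_less_1[of "1 - z"] that by auto
  have "f x = f 0"
  proof (rule constant_on_ray[OF x(1-3)])
    show "(f has_field_derivative 0) (at z)"
      if z: "norm z < 1" "norm (1 - z) < 1" "z \<noteq> 0" "z \<noteq> 1" for z
    proof -
      have "Re z > 0" "Re (1 - z) > 0" using Re[of z] Re[of "1 - z"] z by auto
      hence "z \<notin> \<real>\<^sub>\<le>\<^sub>0" "1 - z \<notin> \<real>\<^sub>\<le>\<^sub>0" by (auto simp: complex_nonpos_Reals_iff)
      hence "(f has_field_derivative
               (Li 1 z / z - Li 1 (1 - z) / (1 - z) + (ln (1 - z) / z - ln z / (1 - z)))) (at z)"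
        unfolding f_def using z by (auto intro!: derivative_eq_intros simp: divide_inverse)
      also have "Li 1 z / z - Li 1 (1 - z) / (1 - z) + (ln (1 - z) / z - ln z / (1 - z)) = 0"
        using z Li_1_complex[of z] Li_1_complex[of "1 - z"] by simp
      finally show ?thesis .
    qed
    have "continuous_on {0..1} (\<lambda>t. ln (of_real t * x) * ln (1 - of_real t * x))"
      unfolding continuous_on_eq_continuous_within
    proof
      fix t :: real assume t: "t \<in> {0..1}"
      show "continuous (at t within {0..1}) (\<lambda>t. ln (of_real t * x) * ln (1 - of_real t * x))"
      proof (cases "t = 0")
        \<comment> \<open>At the origin \<open>ln\<close> is discontinuous, yet the product has
          limit 0, which is its value there because \<open>ln 1 = 0\<close>; this also makes the
          constant \<open>f 0\<close> equal to \<open>Li 2 1\<close>.\<close>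
        case True
        thus ?thesis using ln_ln_tendsto_0[OF x(3)] 
          by (simp add: continuous_within at_within_Icc_at_right)
      next
        case False
        have "of_real t * x \<noteq> 1"
          using lens_ray(4)[OF x(1-3), of t] t x False by (cases "t = 1") auto
        hence "Re (of_real t * x) > 0" "Re (1 - of_real t * x) > 0"
          using Re[of "of_real t * x"] Re[of "1 - of_real t * x"] tx[OF t] x False by auto
        hence "isCont (\<lambda>t. ln (of_real t * x) * ln (1 - of_real t * x)) t"
          by (intro continuous_intros isCont_Ln') (auto simp: complex_nonpos_Reals_iff)
        thus ?thesis by (rule continuous_at_imp_continuous_within)
      qed
    qed
    thus "continuous_on {0..1} (\<lambda>t. f (of_real t * x))"
      unfolding f_def by (rule continuous_on_add[rotated]) (intro continuous_intros; use tx in auto)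
  qed
  thus ?thesis by (simp add: f_def)
qed

lemma gen_harm_2_sums:
  fixes x :: complex
  assumes x: "norm x \<le> 1" "norm (1 - x) \<le> 1" "x \<noteq> 1"
  shows "(\<lambda>n. gen_harm 2 (Suc n) / of_nat (Suc n) * x ^ Suc n) sums
           (2 * Li 3 (1 - x) - 2 * Li 3 1 + Li 3 x - ln (1 - x) * (Li 2 (1 - x) + Li 2 1))"
proof (cases "x = 0")
  case False
  note x = x(1,2) False x(3)
  define G where "G z = (\<Sum>n. gen_harm 2 (Suc n) / of_nat (Suc n) * z ^ Suc n)" for z :: complex
  define f where "f z = G z - (2 * Li 3 (1 - z) - 2 * Li 3 1 + Li 3 z - ln (1 - z) * (Li 2 (1 - z) + Li 2 1))" for z
  have sm: "summable (\<lambda>n. gen_harm 2 (Suc n) / of_nat (Suc n) * x ^ Suc n)"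
  proof (cases "norm x = 1")
    case True
    thus ?thesis using summable_gen_harm_unit_circle[of 2 1 x] x by simp
  next
    case False
    thus ?thesis using x by (intro gen_harm_series) auto
  qed
  have tx: "norm (of_real t * x) \<le> 1" "norm (1 - of_real t * x) \<le> 1" if "t \<in> {0..1}" for t
    using lens_ray(1,2)[OF x(1-3), of t] x that by (cases "t \<in> {0, 1}"; force)+
  have "f x = f 0"
  proof (rule constant_on_ray[OF x(1-3)])
    show "(f has_field_derivative 0) (at z)"
      if z: "norm z < 1" "norm (1 - z) < 1" "z \<noteq> 0" "z \<noteq> 1" for z
    proof -
      have "Re (1 - z) > 0" using Re_less_1[of z] z by auto
      hence nonpos: "1 - z \<notin> \<real>\<^sub>\<le>\<^sub>0" by (auto simp: complex_nonpos_Reals_iff)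
      \<comment> \<open>Expanding the constant \<open>Li 2 1\<close> by reflection at the current
        point produces the product of logarithms that cancels the one from differentiating
        \<open>ln (1 - z) * Li 2 (1 - z)\<close>.\<close>
      have refl: "Li 2 1 = Li 2 z + Li 2 (1 - z) + ln z * ln (1 - z)"
        using dilog_reflection_complex[of z] z by simp
      have G: "(G has_field_derivative Li 2 z / (z * (1 - z))) (at z)"
        unfolding G_def using gen_harm_series(2)[of z 2] z by simp
      have Li1: "Li 1 (1 - z) = - ln z" using Li_1_complex[of "1 - z"] z by simp
      have "(f has_field_derivative (Li 2 z / (z * (1 - z)) - (- 2 * (Li 2 (1 - z) / (1 - z)) + Li 2 z / z
              - (- 1 / (1 - z) * (Li 2 (1 - z) + Li 2 1) - Li 1 (1 - z) / (1 - z) * ln (1 - z))))) (at z)"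
        unfolding f_def using z nonpos
        by (auto intro!: derivative_eq_intros G simp: divide_inverse algebra_simps)
      also have "Li 2 z / (z * (1 - z)) - (- 2 * (Li 2 (1 - z) / (1 - z)) + Li 2 z / z
              - (- 1 / (1 - z) * (Li 2 (1 - z) + Li 2 1) - Li 1 (1 - z) / (1 - z) * ln (1 - z))) = 0"
        unfolding Li1 refl using z by (simp add: divide_simps) (simp add: algebra_simps)
      finally show ?thesis .
    qed
    \<comment> \<open>Splitting off one factor \<open>t\<close> turns the powers
      \<open>t ^ Suc n\<close> into \<open>t ^ n\<close>, so Abel's theorem applies, also when
      \<open>x\<close> is on the unit circle.\<close>
    have "continuous_on {0..1} (\<lambda>t :: real. of_real t * (\<Sum>n. t ^ n *\<^sub>R (gen_harm 2 (Suc n) / of_nat (Suc n) * x ^ Suc n)))"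
      by (intro continuous_intros abel_continuous_on sm)
    also have "?this \<longleftrightarrow> continuous_on {0..1} (\<lambda>t. G (of_real t * x))"
    proof (rule continuous_on_cong)
      fix t :: real assume "t \<in> {0..1}"
      from suminf_mult[OF abel_summable[OF sm this], of "of_real t"]
      show "of_real t * (\<Sum>n. t ^ n *\<^sub>R (gen_harm 2 (Suc n) / of_nat (Suc n) * x ^ Suc n)) = G (of_real t * x)"
        by (simp add: G_def scaleR_conv_of_real power_mult_distrib mult_ac del: of_nat_Suc)
    qed auto
    finally have contG: "continuous_on {0..1} (\<lambda>t. G (of_real t * x))" .
    have "1 - of_real t * x \<notin> \<real>\<^sub>\<le>\<^sub>0" if "t \<in> {0..1}" for t
    proof -
      have "of_real t * x \<noteq> 1"
        using lens_ray(4)[OF x(1-3), of t] that x by (cases "t = 1"; cases "t = 0") auto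
      hence "Re (of_real t * x) < 1"
        using Re_less_1[of "of_real t * x"] tx[OF that] by auto
      thus ?thesis by (auto simp: complex_nonpos_Reals_iff)
    qed
    thus "continuous_on {0..1} (\<lambda>t. f (of_real t * x))"
      unfolding f_def by (intro continuous_intros contG) (use tx in auto)
  qed
  hence "G x = 2 * Li 3 (1 - x) - 2 * Li 3 1 + Li 3 x - ln (1 - x) * (Li 2 (1 - x) + Li 2 1)"
    by (simp add: f_def G_def)
  with sm show ?thesis by (simp add: sums_iff G_def)
qed auto

lemma dilog_reflection_real:
  assumes "0 < x" "x < (1 :: real)"
  shows "ln x * ln (1 - x) = Li 2 1 - Li 2 x - Li 2 (1 - x)"
proof -
  have *: "Li 2 (of_real y) = complex_of_real (Li 2 y)" if "0 \<le> y" "y \<le> 1" for y :: real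
    by (rule Li_of_real) (use that in auto)
  have "norm (1 - complex_of_real x) \<le> 1"
    using assms norm_of_real[of "1 - x", where 'a = complex] by simp
  hence "Li 2 (of_real x) + Li 2 (of_real (1 - x)) + ln (of_real x) * ln (of_real (1 - x)) = Li 2 (complex_of_real 1)"
    using dilog_reflection_complex[of "of_real x"] assms by simp
  hence "complex_of_real (Li 2 x + Li 2 (1 - x) + ln x * ln (1 - x)) = of_real (Li 2 1)"
    using assms by (simp only: * Ln_of_real of_real_add of_real_mult)
  thus ?thesis by (simp only: of_real_eq_iff)
qed

text \<open>The bound \<open>1 / 2 \<le> z\<close> keeps \<open>1 - 1 / z\<close> in [-1, 0], where
  the series converges. The difference of the two sides has derivative zero and vanishes at
  \<open>z = 1\<close>.\<close>

lemma dilog_landen: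
  assumes "1 / 2 \<le> z" "z \<le> (1 :: real)"
  shows "Li 2 (1 - 1 / z) = - (ln z)\<^sup>2 / 2 - Li 2 (1 - z)"
proof -
  define g where "g z = Li 2 (1 - 1 / z) + Li 2 (1 - z) + (ln z)\<^sup>2 / 2" for z :: real
  have "g 1 = g z"
  proof (cases "z = 1")
    case False
    hence "z < 1" using assms by simp
    thus ?thesis
    proof (rule DERIV_isconst_end)
      show "continuous_on {z..1} g"
        unfolding g_def using assms by (intro continuous_intros) (auto simp: abs_le_iff field_simps)
      fix y assume "z < y" "y < 1"
      hence y: "1 / 2 < y" "y < 1" using assms by auto
      have "\<bar>1 - 1 / y\<bar> < 1" "\<bar>1 - y\<bar> < 1" using y by (auto simp: abs_less_iff field_simps)
      moreover from this have "Li 1 (1 - 1 / y) = ln y" "Li 1 (1 - y) = - ln y"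
        using Li_1_real[of "1 - 1 / y"] Li_1_real[of "1 - y"] y by (simp_all add: ln_div)
      ultimately have "(g has_real_derivative (ln y / (1 - 1 / y) / y\<^sup>2 + ln y / (1 - y) + ln y / y)) (at y)"
        unfolding g_def using y
        by (auto intro!: derivative_eq_intros simp: power2_eq_square)
      also have "ln y / (1 - 1 / y) / y\<^sup>2 + ln y / (1 - y) + ln y / y = 0"
        using y by (simp add: divide_simps power2_eq_square) (simp add: algebra_simps)
      finally show "(g has_real_derivative 0) (at y)" .
    qed
  qed auto
  thus ?thesis by (simp add: g_def)
qed

text \<open>The classical identity contains (ln z)^2 ln (1 - z) / 2. Here one factor
  \<open>ln z * ln (1 - z)\<close> is replaced by its reflection formula, so that the expression is
  continuous at \<open>z = 1\<close>, where the constant \<open>Li 3 1\<close> is read off.\<close>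

lemma trilog_landen:
  assumes "1 / 2 \<le> z" "z \<le> (1 :: real)"
  shows "Li 3 z + Li 3 (1 - z) + Li 3 (1 - 1 / z) - (ln z) ^ 3 / 6 - Li 2 1 * ln z
          + ln z * (Li 2 1 - Li 2 z - Li 2 (1 - z)) / 2 = Li 3 1"
proof -
  define g where "g z = Li 3 z + Li 3 (1 - z) + Li 3 (1 - 1 / z) - (ln z) ^ 3 / 6 - Li 2 1 * ln z
          + ln z * (Li 2 1 - Li 2 z - Li 2 (1 - z)) / 2" for z :: real
  have "g 1 = g z"
  proof (cases "z = 1")
    case False
    hence "z < 1" using assms by simp
    thus ?thesis
    proof (rule DERIV_isconst_end)
      show "continuous_on {z..1} g"
        unfolding g_def using assms by (intro continuous_intros) (auto simp: abs_le_iff field_simps)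
      fix y assume "z < y" "y < 1"
      hence y: "1 / 2 < y" "y < 1" using assms by auto
      have bounds: "\<bar>y\<bar> < 1" "\<bar>1 - 1 / y\<bar> < 1" "\<bar>1 - y\<bar> < 1" "1 - 1 / y \<noteq> 0" "1 - y \<noteq> 0" "y \<noteq> 0"
        using y by (auto simp: abs_less_iff field_simps)
      have Li1: "Li 1 (1 - y) = - ln y" "Li 1 y = - ln (1 - y)"
        using Li_1_real[of y] Li_1_real[of "1 - y"] bounds by simp_all
      define P Q L M where "P = Li 2 y" and "Q = Li 2 (1 - y)" and "L = ln y" and "M = ln (1 - y)"
      have LM: "L * M = Li 2 1 - P - Q"
        unfolding L_def M_def P_def Q_def by (rule dilog_reflection_real) (use y in auto)
      have "(g has_real_derivative
              (Li 2 y / y - Li 2 (1 - y) / (1 - y) + Li 2 (1 - 1 / y) / (1 - 1 / y) / y\<^sup>2 - (ln y)\<^sup>2 / y / 2 - Li 2 1 / y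
                + (1 / y * (Li 2 1 - Li 2 y - Li 2 (1 - y)) + ln y * (- (Li 1 y / y) + Li 1 (1 - y) / (1 - y))) / 2)) (at y)"
        unfolding g_def using bounds y
        by (auto intro!: derivative_eq_intros simp: power2_eq_square)
           (simp add: field_simps)
      also have "Li 2 y / y - Li 2 (1 - y) / (1 - y) + Li 2 (1 - 1 / y) / (1 - 1 / y) / y\<^sup>2 - (ln y)\<^sup>2 / y / 2 - Li 2 1 / y
                + (1 / y * (Li 2 1 - Li 2 y - Li 2 (1 - y)) + ln y * (- (Li 1 y / y) + Li 1 (1 - y) / (1 - y))) / 2 =
             P / y - Q / (1 - y) + (L\<^sup>2 / 2 + Q) * (1 / y + 1 / (1 - y)) - L\<^sup>2 / y / 2 - Li 2 1 / y
                + (1 / y * (Li 2 1 - P - Q) + L * (M / y - L / (1 - y))) / 2"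
      proof -
        have "(- L\<^sup>2 / 2 - Q) / (1 - 1 / y) / y\<^sup>2 = (L\<^sup>2 / 2 + Q) * (1 / y + 1 / (1 - y))"
          using bounds by (simp add: divide_simps power2_eq_square) (simp add: algebra_simps)
        thus ?thesis
          using dilog_landen[of y] y unfolding Li1 P_def Q_def L_def M_def by simp
      qed
      also have "\<dots> = (P + Q - Li 2 1 + (Li 2 1 - P - Q) / 2 + (L * M) / 2) / y"
        using bounds by (simp add: divide_simps power2_eq_square) (simp add: algebra_simps)
      also have "\<dots> = 0" unfolding LM by (simp add: field_simps)
      finally show "(g has_real_derivative 0) (at y)" .
    qed
  qed auto
  thus ?thesis by (simp add: g_def)
qed

text \<open>Adding the series at 1 and at -1 cancels odd denominators and doubles even ones: the sum
  is 2/8 of \<open>Li 3 1\<close>, and 1/4 - 1 = -3/4.\<close>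

lemma Li_3_minus_1: "Li 3 (-1 :: real) = - 3 / 4 * Li 3 1"
proof -
  have "(\<lambda>n. 1 / real (Suc n) ^ 3 + (-1) ^ Suc n / real (Suc n) ^ 3) sums (Li 3 1 + Li 3 (-1))"
    using summable_sums[OF summable_Li[of "1 :: real" 3]] summable_sums[OF summable_Li[of "-1 :: real" 3]]
    by (intro sums_add) (simp_all add: Li_def)
  also have "?this \<longleftrightarrow> (\<lambda>m. 1 / real (Suc (2 * m + 1)) ^ 3 + (-1) ^ Suc (2 * m + 1) / real (Suc (2 * m + 1)) ^ 3) sums (Li 3 1 + Li 3 (-1))"
  proof (rule sums_mono_reindex[symmetric, of "\<lambda>m. 2 * m + 1"])
    fix m :: nat
    assume "m \<notin> range (\<lambda>m. 2 * m + 1)"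
    hence "even m" by (metis oddE rangeI)
    thus "1 / real (Suc m) ^ 3 + (-1) ^ Suc m / real (Suc m) ^ 3 = 0" by simp
  qed (auto simp: strict_mono_def)
  also have "(\<lambda>m. 1 / real (Suc (2 * m + 1)) ^ 3 + (-1) ^ Suc (2 * m + 1) / real (Suc (2 * m + 1)) ^ 3) =
             (\<lambda>m. 1 / 4 * (1 / real (Suc m) ^ 3))"
  proof
    fix m
    have "real (Suc (2 * m + 1)) = 2 * real (Suc m)" by simp
    thus "1 / real (Suc (2 * m + 1)) ^ 3 + (-1) ^ Suc (2 * m + 1) / real (Suc (2 * m + 1)) ^ 3 =
             1 / 4 * (1 / real (Suc m) ^ 3)"
      by (simp only: power_mult_distrib) simp
  qed
  finally have "(\<lambda>m. 1 / 4 * (1 / real (Suc m) ^ 3)) sums (Li 3 1 + Li 3 (-1))" .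
  moreover have "(\<lambda>m. 1 / 4 * (1 / real (Suc m) ^ 3)) sums (1 / 4 * Li 3 1)"
    using summable_sums[OF summable_Li[of "1 :: real" 3]] by (intro sums_mult) (simp add: Li_def)
  ultimately show ?thesis using sums_unique2 by fastforce
qed

section \<open>Values at 1/2 and the series evaluated there\<close>

lemma Li_2_half: "Li 2 (1 / 2 :: real) = Li 2 1 / 2 - (ln 2)\<^sup>2 / 2"
  using dilog_reflection_real[of "1 / 2"] by (simp add: ln_div power2_eq_square field_simps)

text \<open>The point 1/2 is fixed by z \<mapsto> 1 - z and sent to -1 by z \<mapsto> 1 - 1/z, so
  Landen's identity becomes an equation for 2 Li_3(1/2) + Li_3(-1).\<close>

lemma Li_3_half: "Li 3 (1 / 2 :: real) = 7 / 8 * Li 3 1 - Li 2 1 * ln 2 / 2 + (ln 2) ^ 3 / 6"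
  using trilog_landen[of "1 / 2"]
  by (simp add: Li_2_half Li_3_minus_1 ln_div field_simps power2_eq_square power3_eq_cube)

text \<open>All terms with \<open>ln 2\<close> cancel, leaving 3 * 7/8 - 2 = 5/8.\<close>

lemma gen_harm_2_half_sums:
  "(\<lambda>n. gen_harm 2 (Suc n) / (real (Suc n) * 2 ^ Suc n)) sums (5 / 8 * Li 3 1)"
proof -
  have half: "Li k (1 / 2 :: complex) = of_real (Li k (1 / 2))" for k
    using Li_of_real[of "1 / 2" k, where ?'a = complex] by simp
  have one: "Li k (1 :: complex) = of_real (Li k 1)" if "k \<ge> 2" for k
    using Li_of_real[of 1 k, where ?'a = complex] that by simp
  have ln_half: "ln (1 / 2 :: complex) = of_real (- ln 2)"
    using Ln_of_real[of "1 / 2"] by (simp add: ln_div)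
  have "(\<lambda>n. gen_harm 2 (Suc n) / of_nat (Suc n) * (1 / 2) ^ Suc n) sums
          complex_of_real (2 * Li 3 (1 / 2) - 2 * Li 3 1 + Li 3 (1 / 2) - (- ln 2) * (Li 2 (1 / 2) + Li 2 1))"
    using gen_harm_2_sums[of "1 / 2"] by (simp add: half one ln_half)
  also have "2 * Li 3 (1 / 2) - 2 * Li 3 1 + Li 3 (1 / 2) - (- ln 2) * (Li 2 (1 / 2) + Li 2 1) = 5 / 8 * Li 3 (1 :: real)"
    by (simp add: Li_2_half Li_3_half field_simps power2_eq_square power3_eq_cube)
  also have "(\<lambda>n. gen_harm 2 (Suc n) / of_nat (Suc n) * (1 / 2) ^ Suc n) =
      (\<lambda>n. complex_of_real (gen_harm 2 (Suc n) / (real (Suc n) * 2 ^ Suc n)))"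
    by (simp add: gen_harm_def power_divide fun_eq_iff del: of_nat_Suc)
  finally show ?thesis by (simp only: sums_of_real_iff)
qed

text \<open>The closed form comes from integrating Li_3(z)/z + Li_3(z)/(1 - z). The first part gives
  Li_4; the second, by parts, gives - ln(1 - z) Li_3(z) minus the integral of Li_1(z) Li_2(z)/z,
  which is half of Li_2(z)^2.\<close>

lemma gen_harm_3_series:
  assumes "0 < x" "x < (1 :: real)"
  shows "(\<lambda>n. gen_harm 3 (Suc n) / real (Suc n) * x ^ Suc n) sums
           (Li 4 x - ln (1 - x) * Li 3 x - (Li 2 x)\<^sup>2 / 2)"
proof -
  define G where "G z = (\<Sum>n. gen_harm 3 (Suc n) / real (Suc n) * z ^ Suc n)" for z :: real
  define f where "f z = G z - (Li 4 z - ln (1 - z) * Li 3 z - (Li 2 z)\<^sup>2 / 2)" for z :: real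
  have "f x = f 0"
    using assms(1)
  proof (rule DERIV_isconst_end)
    have "isCont G z" if "norm z < 1" for z
      unfolding G_def by (rule DERIV_isCont[OF DERIV_powser_Suc(1)[OF sums_summable[OF gen_harm_sums] that]])
    hence "continuous_on {0..x} G"
      using assms by (intro continuous_at_imp_continuous_on) auto
    thus "continuous_on {0..x} f"
      unfolding f_def using assms by (intro continuous_intros) auto
    fix z assume z: "0 < z" "z < x"
    have G: "(G has_field_derivative Li 3 z / (z * (1 - z))) (at z)"
      unfolding G_def using gen_harm_series(2)[of z 3] z assms by simp
    have "(f has_real_derivative (Li 3 z / (z * (1 - z)) - (Li 3 z / z - (- 1 / (1 - z) * Li 3 z + Li 2 z / z * ln (1 - z))
            - 2 * Li 2 z * (Li 1 z / z) / 2))) (at z)"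
      unfolding f_def using z assms
      by (auto intro!: derivative_eq_intros G)
    also have "Li 1 z = - ln (1 - z)" using Li_1_real[of z] z assms by simp
    also have "Li 3 z / (z * (1 - z)) - (Li 3 z / z - (- 1 / (1 - z) * Li 3 z + Li 2 z / z * ln (1 - z))
            - 2 * Li 2 z * (- ln (1 - z) / z) / 2) = 0"
      using z assms by (simp add: divide_simps) (simp add: algebra_simps)
    finally show "(f has_real_derivative 0) (at z)" .
  qed
  hence "G x = Li 4 x - ln (1 - x) * Li 3 x - (Li 2 x)\<^sup>2 / 2"
    by (simp add: f_def G_def)
  with gen_harm_series(1)[of x 3] assms show ?thesis by (simp add: sums_iff G_def)
qed

lemma gen_harm_3_half_sums:
  "(\<lambda>n. gen_harm 3 (Suc n) / (real (Suc n) * 2 ^ Suc n)) sums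
     (Li 4 (1 / 2) + 7 / 8 * Li 3 1 * ln 2 - 1 / 4 * Li 2 1 * (ln 2)\<^sup>2 + 1 / 24 * (ln 2) ^ 4 - (Li 2 1)\<^sup>2 / 8)"
proof -
  have "(\<lambda>n. gen_harm 3 (Suc n) / real (Suc n) * (1 / 2) ^ Suc n) sums
          (Li 4 (1 / 2) - ln (1 - 1 / 2) * Li 3 (1 / 2) - (Li 2 (1 / 2))\<^sup>2 / 2)"
    by (rule gen_harm_3_series) auto
  also have "Li 4 (1 / 2) - ln (1 - 1 / 2) * Li 3 (1 / 2) - (Li 2 (1 / 2))\<^sup>2 / 2 =
     Li 4 (1 / 2) + 7 / 8 * Li 3 1 * ln 2 - 1 / 4 * Li 2 1 * (ln 2)\<^sup>2 + 1 / 24 * (ln 2) ^ 4 - (Li 2 1)\<^sup>2 / (8 :: real)"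
    unfolding Li_2_half Li_3_half by (simp add: ln_div field_simps eval_nat_numeral)
  finally show ?thesis by (simp add: power_divide)
qed

text \<open>In (f) the closed form is that of \<open>gen_harm_3_half_sums\<close> with zeta(2)^2 / 8
  = 5/16 zeta(4); numerically it is about 0.720, like the series. The right side displayed in
  English is about 0.540, already exceeded by the first three terms of the series, so the formal (f)
  is a corrected identity.\<close>

theorem theorem4p9:
  shows
    "(\<forall>x :: complex. norm x \<le> 1 \<and> norm (1 - x) \<le> 1 \<and> x \<noteq> 1 \<longrightarrow>
        (\<lambda>n. gen_harm 2 (Suc n) / of_nat (Suc n) * x ^ Suc n) sums
          (2 * polylog 3 (1 - x) - 2 * zeta 3 + polylog 3 x
            - ln (1 - x) * (polylog 2 (1 - x) + zeta 2)))
     \<and> (\<lambda>n. gen_harm 2 (Suc n) / (real (Suc n) * 2 ^ Suc n)) sums (5 / 8 * zeta 3)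
     \<and> (\<forall>(s :: complex) (x :: complex).
          norm x < 1 \<or> (norm x = 1 \<and> (Re s > 1 \<or> (x \<noteq> 1 \<and> Re s > 0))) \<longrightarrow>
          (\<lambda>y. (polylog s x - polylog s y) / (x - y)) contour_integrable_on (linepath 0 x) \<and>
          (\<lambda>n. gen_harm 1 (Suc n) / of_nat (Suc n) powr s * x ^ Suc n) sums
            contour_integral (linepath 0 x) (\<lambda>y. (polylog s x - polylog s y) / (x - y)))
     \<and> ((\<lambda>n. gen_harm 1 (Suc n) / real (Suc n) ^ 3) sums (1 / 2 * (zeta 2)\<^sup>2)
         \<and> 1 / 2 * (zeta 2)\<^sup>2 = pi ^ 4 / 72
         \<and> pi ^ 4 / 72 = 5 / 4 * zeta 4)
     \<and> ((\<lambda>n. (gen_harm 1 (Suc n))\<^sup>2 / (real (Suc n))\<^sup>2) sums (17 / 360 * pi ^ 4)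
         \<and> 17 / 360 * pi ^ 4 = 17 / 4 * zeta 4)
     \<and> (\<lambda>n. gen_harm 3 (Suc n) / (real (Suc n) * 2 ^ Suc n)) sums
          (polylog 4 (1 / 2) + 7 / 8 * zeta 3 * ln 2 - 1 / 4 * zeta 2 * (ln 2)\<^sup>2
            + 1 / 24 * (ln 2) ^ 4 - 5 / 16 * zeta 4)"
proof (intro conjI allI impI)
  fix x :: complex
  assume "norm x \<le> 1 \<and> norm (1 - x) \<le> 1 \<and> x \<noteq> 1"
  thus "(\<lambda>n. gen_harm 2 (Suc n) / of_nat (Suc n) * x ^ Suc n) sums
          (2 * polylog 3 (1 - x) - 2 * zeta 3 + polylog 3 x
            - ln (1 - x) * (polylog 2 (1 - x) + zeta 2))"
    using gen_harm_2_sums[of x] polylog_eq_Li_complex[of 2] polylog_eq_Li_complex[of 3]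
      zeta_eq_Li_complex[of 2] zeta_eq_Li_complex[of 3] by simp
next
  show "(\<lambda>n. gen_harm 2 (Suc n) / (real (Suc n) * 2 ^ Suc n)) sums (5 / 8 * zeta 3)"
    using gen_harm_2_half_sums zeta_eq_Li_real[of 3] by simp
  have eq: "5 / 16 * zeta 4 = (Li 2 (1 :: real))\<^sup>2 / 8"
    using zeta_2_squared zeta_eq_Li_real[of 2] by simp
  show "(\<lambda>n. gen_harm 3 (Suc n) / (real (Suc n) * 2 ^ Suc n)) sums
          (polylog 4 (1 / 2) + 7 / 8 * zeta 3 * ln 2 - 1 / 4 * zeta 2 * (ln 2)\<^sup>2
            + 1 / 24 * (ln 2) ^ 4 - 5 / 16 * zeta 4)"
    unfolding eq using gen_harm_3_half_sums zeta_eq_Li_real[of 2] zeta_eq_Li_real[of 3] polylog_eq_Li_real[of 4] by simp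
  show "(\<lambda>n. gen_harm 1 (Suc n) / real (Suc n) ^ 3) sums (1 / 2 * (zeta 2)\<^sup>2)"
    using sums_harm_over_cube by (simp add: zeta_2_squared)
  show "(\<lambda>n. (gen_harm 1 (Suc n))\<^sup>2 / (real (Suc n))\<^sup>2) sums (17 / 360 * pi ^ 4)"
    using sums_harm_squared_over_square by (simp add: zeta_4)
next
  fix s x :: complex
  assume "norm x < 1 \<or> (norm x = 1 \<and> (Re s > 1 \<or> (x \<noteq> 1 \<and> Re s > 0)))"
  note sm = summable_harm_polylog[OF this]
  from polylog_integral[OF sm]
  show "(\<lambda>y. (polylog s x - polylog s y) / (x - y)) contour_integrable_on (linepath 0 x)"
    by (auto simp: contour_integrable_on_def)
  show "(\<lambda>n. gen_harm 1 (Suc n) / of_nat (Suc n) powr s * x ^ Suc n) sums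
            contour_integral (linepath 0 x) (\<lambda>y. (polylog s x - polylog s y) / (x - y))"
    using summable_sums[OF sm] contour_integral_unique[OF polylog_integral[OF sm]] by simp
qed (simp_all add: zeta_2 zeta_4 power_divide)

end
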